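(* Let $c>0$, $q=e^{-\pi c}$, and let $k\in(0,1)$ be the elliptic modulus with $c=K(\sqrt{1-k^2})/K(k)$. Assume that $X_{\theta_3(c)}$ and $X'_{\theta_3(c)}$ are two independent $\theta_3(c)$-distributed random variables. Then for two arbitrary real numbers $a$ and $b$, $$aX_{\theta_3(c)}+bX'_{\theta_3(c)}\stackrel{(d)}{=}\pi_c Z_3+(1-\pi_c)Z_2,$$ where $\stackrel{(d)}{=}$ denotes equality in distribution, $$Z_3:=a\left(X_{\theta_3(2c)}+X'_{\theta_3(2c)}\right)+b\left(X_{\theta_3(2c)}-X'_{\theta_3(2c)}\right),$$ $$Z_2:=a\left(X_{\theta_2(2c)}+X'_{\theta_2(2c)}+1\right)+b\left(X_{\theta_2(2c)}-X'_{\theta_2(2c)}\right),$$ the variables $X_{\theta_3(2c)},X'_{\theta_3(2c)}$ are $\theta_3(2c)$-distributed, the variables $X_{\theta_2(2c)},X'_{\theta_2(2c)}$ are $\theta_2(2c)$-distributed, and $\pi_c$ is a Bernoulli random variable with $$\mathbb{P}(\pi_c=1)=p_c=\frac{\theta_3^2(0,q^2)}{\theta_3^2(0,q)}=\frac{\theta_3^2(0,e^{-2\pi c})}{\theta_3^2(0,e^{-\pi c})}=\frac{1+\sqrt{1-k^2}}{2}=1-k(q^2)$$ and $$\mathbb{P}(\pi_c=0)=1-p_c=\frac{\theta_2^2(0,q^2)}{\theta_3^2(0,q)}=\frac{1-\sqrt{1-k^2}}{2}=k(q^2).$$ The random variables $X_{\theta_2(2c)},X'_{\theta_2(2c)},X_{\theta_3(2c)},X'_{\theta_3(2c)}$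 and $\pi_c$ are taken to be independent.
   Context: For $0<q<1$: $\theta_2(0,q)=\sum_{n\in\mathbb{Z}}q^{(n+\frac12)^2}$ and $\theta_3(0,q)=\sum_{n\in\mathbb{Z}}q^{n^2}$. For $c>0$, the discrete Gaussian $\theta_2$-distribution with lattice parameter $\imath c$ (written $\theta_2(c)$) is the law on $\mathbb{Z}$ given by $\mathbb{P}\{X=n\}=e^{-c\pi(n+\frac12)^2}/\theta_2(0,e^{-c\pi})$; the discrete Gaussian $\theta_3$-distribution with lattice parameter $\imath c$ (written $\theta_3(c)$) is the law on $\mathbb{Z}$ given by $\mathbb{P}\{X=n\}=e^{-c\pi n^2}/\theta_3(0,e^{-c\pi})$. $K(k)=\int_0^1\frac{dt}{\sqrt{1-t^2}\sqrt{1-k^2t^2}}$ for $k\in(0,1)$; the map $k\mapsto K(\sqrt{1-k^2})/K(k)$ is a bijection from $(0,1)$ onto $(0,\infty)$. The nome associated with the elliptic modulus $k$ is $q=e^{-\pi K(\sqrt{1-k^2})/K(k)}$, and $k(q^2)$ denotes the elliptic modulus associated with the nome $q^2$.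
   Formalization: The printed last equalities p_c = 1 - k(q^2) and 1 - p_c = k(q^2) are false for every c > 0 (for c = 1: 0.8536 versus 0.8284); they are replaced by p_c = 1/(1 + k(q^2)) and 1 - p_c = k(q^2)/(1 + k(q^2)). *)

theory Defs
  imports "HOL-Probability.Probability"
begin

(* theta2 q and theta3 q are the theta constants theta_2(0,q) and theta_3(0,q), for 0 < q < 1. *)

definition theta2 :: "real \<Rightarrow> real" where
  "theta2 q = (\<Sum>\<^sub>\<infinity>n::int. q powr ((of_int n + 1/2)\<^sup>2))"

definition theta3 :: "real \<Rightarrow> real" where
  "theta3 q = (\<Sum>\<^sub>\<infinity>n::int. q powr ((of_int n)\<^sup>2))"

(* Complete elliptic integral of the first kind as a function of the modulus k, not of the
   parameter k^2. The integrand has an integrable singularity at t = 1. *)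
definition elliptic_K :: "real \<Rightarrow> real" where
  "elliptic_K k = integral {0..1} (\<lambda>t. 1 / (sqrt (1 - t\<^sup>2) * sqrt (1 - k\<^sup>2 * t\<^sup>2)))"

definition elliptic_nome :: "real \<Rightarrow> real" where
  "elliptic_nome k = exp (- pi * elliptic_K (sqrt (1 - k\<^sup>2)) / elliptic_K k)"

(* The modulus k(q): inverse of elliptic_nome, which is a bijection of (0,1) onto itself.
   By Landen's transformation k(q^2) = (1 - k') / (1 + k') with k = k(q), k' = sqrt (1 - k^2), so
   that (1 - k') / 2 is k(q^2) / (1 + k(q^2)) and not k(q^2). *)
definition elliptic_modulus :: "real \<Rightarrow> real" where
  "elliptic_modulus q = (THE k. k \<in> {0<..<1} \<and> elliptic_nome k = q)"

(* Discrete Gaussian laws on the integers with lattice parameter i * c, for c > 0. *)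

definition theta2_distributed :: "real \<Rightarrow> 'a measure \<Rightarrow> ('a \<Rightarrow> int) \<Rightarrow> bool" where
  "theta2_distributed c M X \<longleftrightarrow>
     X \<in> measurable M (count_space UNIV) \<and>
     (\<forall>n. measure M {\<omega> \<in> space M. X \<omega> = n} =
          exp (- c * pi * (of_int n + 1/2)\<^sup>2) / theta2 (exp (- c * pi)))"

definition theta3_distributed :: "real \<Rightarrow> 'a measure \<Rightarrow> ('a \<Rightarrow> int) \<Rightarrow> bool" where
  "theta3_distributed c M X \<longleftrightarrow>
     X \<in> measurable M (count_space UNIV) \<and>
     (\<forall>n. measure M {\<omega> \<in> space M. X \<omega> = n} =
          exp (- c * pi * (of_int n)\<^sup>2) / theta3 (exp (- c * pi)))"

(* Bernoulli variables are integer valued so that they can be a member of one independent family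
   together with the discrete Gaussian variables. *)
definition bernoulli_distributed :: "real \<Rightarrow> 'a measure \<Rightarrow> ('a \<Rightarrow> int) \<Rightarrow> bool" where
  "bernoulli_distributed p M B \<longleftrightarrow>
     B \<in> measurable M (count_space UNIV) \<and>
     measure M {\<omega> \<in> space M. B \<omega> = 1} = p \<and>
     measure M {\<omega> \<in> space M. B \<omega> = 0} = 1 - p"

end

theory Submission
  imports Defs "HOL-Real_Asymp.Real_Asymp"
begin

text \<open>
  The change of lattice coordinates (m, n) = (u + v, u - v) for m + n even and
  (m, n) = (u + v + 1, u - v) for m + n odd turns m^2 + n^2 into 2 u^2 + 2 v^2 and
  2 (u + 1/2)^2 + 2 (v + 1/2)^2 respectively; this gives both the distributional identity and the
  duplication formula for the square of theta3, hence the theta quotients for p.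

  To express p through k, put a = theta3(q)^2 and d = theta2(q)^2. The duplication formulas say that
  passing from q to q^2 is one step of the arithmetic-geometric mean on (a, sqrt (a^2 - d^2)), and
  an inverse step (up to a factor 2) on (a, d). As the complete elliptic integral is invariant
  under the mean, the ratio f(q) = K(k')/K(k) at k = d/a satisfies f(q^2) = 2 f(q). Together with
  K(k') ~ ln (1/k) for k near 0 this forces f(q) = - ln q / pi, without Poisson summation.
  Since K is strictly increasing, k = d/a is the only modulus with nome q.
\<close>

section \<open>Complete elliptic integrals and the arithmetic-geometric mean\<close>

text \<open>\<open>elliptic_modulus\<close> is a definite description, so nothing can be said about
  \<open>k(q^2)\<close> until a modulus with the right nome is exhibited and shown to be the only
  one. The theta quotient is the explicit witness, which requires its period ratio exactly and not
  just up to a constant. The iteration runs towards nome 0 because everything is elementary there: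
  \<open>theta3\<close> tends to 1, \<open>theta2\<close> behaves like \<open>2 q^(1/4)\<close>,
  hence \<open>k\<close> like \<open>4 q^(1/2)\<close>, and K(k) tends to pi/2. The quotient of
  K(k')/K(k) by \<open>- ln q\<close> does not change when \<open>q\<close> is squared, so it equals
  its limit at 0, which is (1/2) / (pi/2) = 1/pi. The integrals are put into a homogeneous form with
  two arguments: the squares of the theta constants can then be inserted without normalisation, and
  a step of the mean is one algebraic substitution. On the probabilistic side the joint law of the
  pair is compared, not the law of the linear combination: the parity of the coordinate sum of the
  pair reveals the Bernoulli variable, whereas the value of the combination alone may not. The
  coefficients \<open>a\<close> and \<open>b\<close> enter only through a final pushforward.\<close>

text \<open>The integrand \<open>h\<close> is given pointwise, so that each later substitution
  reduces to one algebraic identity. Integrability is asked for on the target side only, which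
  avoids estimates at a singular endpoint on the source side.\<close>

lemma absolutely_integrable_substitution:
  fixes f g g' h :: "real \<Rightarrow> real"
  assumes S: "S \<in> sets lebesgue"
    and der: "\<And>x. x \<in> S \<Longrightarrow> (g has_field_derivative g' x) (at x within S)"
    and inj: "inj_on g S" and img: "g ` S = T"
    and h: "\<And>x. x \<in> S \<Longrightarrow> h x = \<bar>g' x\<bar> * f (g x)"
    and f: "f absolutely_integrable_on T"
  shows "h absolutely_integrable_on S" "integral S h = integral T f"
proof -
  let ?h = "\<lambda>x. \<bar>g' x\<bar> * f (g x)"
  have *: "?h absolutely_integrable_on S \<and> integral S ?h = integral T f"
    using has_absolute_integral_change_of_variables_1'[OF S der inj] f img by blast
  then have "?h absolutely_integrable_on S"
    by blast
  then show "h absolutely_integrable_on S"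
    by (rule absolutely_integrable_spike[where S = "{}"]) (auto simp: h)
  have "integral S h = integral S ?h"
    by (rule integral_cong) (rule h)
  with * show "integral S h = integral T f"
    by simp
qed

text \<open>Gauss's integral: \<open>x = b tan \<phi>\<close> turns it into the integral of
  \<open>1 / sqrt (a^2 cos^2 \<phi> + b^2 sin^2 \<phi>)\<close> over a quarter period, which is pi
  divided by twice the arithmetic-geometric mean of \<open>a\<close> and \<open>b\<close>. It is
  homogeneous of degree -1 and decreasing in both arguments.\<close>

definition ellint :: "real \<Rightarrow> real \<Rightarrow> real" where
  "ellint a b = integral {0<..} (\<lambda>x. 1 / (sqrt (x\<^sup>2 + a\<^sup>2) * sqrt (x\<^sup>2 + b\<^sup>2)))"

lemma cauchy_density_half_line:
  fixes a :: real
  assumes a: "a > 0"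
  shows "(\<lambda>x. 1 / (x\<^sup>2 + a\<^sup>2)) absolutely_integrable_on {0<..}"
    and "integral {0<..} (\<lambda>x. 1 / (x\<^sup>2 + a\<^sup>2)) = pi / (2 * a)"
proof -
  let ?f = "\<lambda>x::real. 1 / (1 + x\<^sup>2)"
  have S: "einterval 0 \<infinity> = {0::real<..}"
    by (auto simp: einterval_def zero_ereal_def)
  have si: "set_integrable lborel {0<..} ?f"
    using integrable_I0i_1_div_plus_square by (simp add: interval_lebesgue_integrable_def S)
  have ai: "?f absolutely_integrable_on {0<..}"
    using si integrable_completion set_integrable_def
    by (smt (verit) absolutely_integrable_on_def absolutely_integrable_on_iff_nonneg
        divide_nonneg_nonneg set_borel_integral_eq_integral(1) zero_le_power2)
  have val: "integral {0<..} ?f = pi / 2"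
    using LBINT_I0i_1_div_plus_square set_borel_integral_eq_integral(2)[OF si]
    by (simp add: interval_lebesgue_integral_def S)
  have ai': "(\<lambda>x. ?f x / a) absolutely_integrable_on {0<..}"
    using set_integrable_divide[OF ai] by simp
  have eq: "1 / (x\<^sup>2 + a\<^sup>2) = \<bar>1 / a\<bar> * (?f (x / a) / a)" for x
  proof -
    have "x\<^sup>2 + a\<^sup>2 = a\<^sup>2 * (1 + (x / a)\<^sup>2)"
      using a by (simp add: field_simps)
    then show ?thesis
      using a by (simp add: power2_eq_square)
  qed
  have img: "(\<lambda>x. x / a) ` {0<..} = {0<..}"
  proof (intro equalityI subsetI)
    fix y :: real assume "y \<in> {0<..}"
    then show "y \<in> (\<lambda>x. x / a) ` {0<..}"
      using a by (intro image_eqI[of _ _ "y * a"]) auto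
  qed (use a in auto)
  have der: "((\<lambda>x. x / a) has_field_derivative 1 / a) (at x within {0<..})" for x
    using a by (auto intro!: derivative_eq_intros)
  have inj: "inj_on (\<lambda>x. x / a) {0<..}"
    using a by (auto simp: inj_on_def)
  note sub = absolutely_integrable_substitution[OF _ der inj img eq ai']
  show "(\<lambda>x. 1 / (x\<^sup>2 + a\<^sup>2)) absolutely_integrable_on {0<..}"
    by (rule sub) auto
  have "integral {0<..} (\<lambda>x. 1 / (x\<^sup>2 + a\<^sup>2)) = integral {0<..} (\<lambda>x. ?f x / a)"
    by (rule sub) auto
  also have "\<dots> = integral {0<..} ?f / a"
    by (rule integral_divide)
  also have "\<dots> = pi / (2 * a)"
    unfolding val by simp
  finally show "integral {0<..} (\<lambda>x. 1 / (x\<^sup>2 + a\<^sup>2)) = pi / (2 * a)" .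
qed

lemma ellint_diag:
  assumes "a > 0"
  shows "ellint a a = pi / (2 * a)"
proof -
  have "sqrt (x\<^sup>2 + a\<^sup>2) * sqrt (x\<^sup>2 + a\<^sup>2) = x\<^sup>2 + a\<^sup>2" for x
    by simp
  then show ?thesis
    unfolding ellint_def using cauchy_density_half_line(2)[OF assms] by simp
qed

lemma ellint_integrand_antimono:
  fixes a b a' b' x :: real
  assumes "0 < a" "a \<le> a'" "0 < b" "b \<le> b'"
  shows "1 / (sqrt (x\<^sup>2 + a'\<^sup>2) * sqrt (x\<^sup>2 + b'\<^sup>2)) \<le> 1 / (sqrt (x\<^sup>2 + a\<^sup>2) * sqrt (x\<^sup>2 + b\<^sup>2))"
proof (rule divide_left_mono)
  have "a\<^sup>2 \<le> a'\<^sup>2" "b\<^sup>2 \<le> b'\<^sup>2"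
    using assms by (auto intro: power_mono)
  then show "sqrt (x\<^sup>2 + a\<^sup>2) * sqrt (x\<^sup>2 + b\<^sup>2) \<le> sqrt (x\<^sup>2 + a'\<^sup>2) * sqrt (x\<^sup>2 + b'\<^sup>2)"
    by (intro mult_mono) auto
  show "0 < sqrt (x\<^sup>2 + a'\<^sup>2) * sqrt (x\<^sup>2 + b'\<^sup>2) * (sqrt (x\<^sup>2 + a\<^sup>2) * sqrt (x\<^sup>2 + b\<^sup>2))"
    using assms by (intro mult_pos_pos) (auto intro!: add_nonneg_pos)
qed auto

lemma continuous_on_ellint_integrand:
  fixes a b :: real
  assumes "a > 0" "b > 0"
  shows "continuous_on S (\<lambda>x. 1 / (sqrt (x\<^sup>2 + a\<^sup>2) * sqrt (x\<^sup>2 + b\<^sup>2)))"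
proof -
  have "sqrt (x\<^sup>2 + a\<^sup>2) * sqrt (x\<^sup>2 + b\<^sup>2) \<noteq> 0" for x
    using assms by (auto simp: add_nonneg_eq_0_iff)
  then show ?thesis
    by (intro continuous_intros) auto
qed

lemma ellint_integrable:
  assumes a: "a > 0" and b: "b > 0"
  shows "(\<lambda>x. 1 / (sqrt (x\<^sup>2 + a\<^sup>2) * sqrt (x\<^sup>2 + b\<^sup>2))) absolutely_integrable_on {0<..}"
proof (rule measurable_bounded_by_integrable_imp_absolutely_integrable)
  define m where "m = min a b"
  have m: "m > 0" "m \<le> a" "m \<le> b"
    using assms by (auto simp: m_def)
  show "(\<lambda>x. 1 / (sqrt (x\<^sup>2 + a\<^sup>2) * sqrt (x\<^sup>2 + b\<^sup>2))) \<in> borel_measurable (lebesgue_on {0<..})"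
    by (rule continuous_imp_measurable_on_sets_lebesgue)
      (use continuous_on_ellint_integrand[OF assms] in auto)
  show "(\<lambda>x. 1 / (x\<^sup>2 + m\<^sup>2)) integrable_on {0<..}"
    using cauchy_density_half_line(1)[OF m(1)] by (rule set_lebesgue_integral_eq_integral(1))
  show "norm (1 / (sqrt (x\<^sup>2 + a\<^sup>2) * sqrt (x\<^sup>2 + b\<^sup>2))) \<le> 1 / (x\<^sup>2 + m\<^sup>2)" for x
    using ellint_integrand_antimono[of m a m b x] m by simp
qed auto

lemma ellint_antimono:
  assumes "0 < a" "a \<le> a'" "0 < b" "b \<le> b'"
  shows "ellint a' b' \<le> ellint a b"
  unfolding ellint_def
  by (intro integral_le ellint_integrand_antimono set_lebesgue_integral_eq_integral(1)
      ellint_integrable) (use assms in auto)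

text \<open>The strict gap comes from the compact interval \<open>{0..1}\<close>, where the
  continuous integrands are strictly ordered; the rest of the half line adds a nonnegative
  difference.\<close>

lemma ellint_strict_antimono:
  assumes a: "a > 0" and b: "0 < b" "b < b'"
  shows "ellint a b' < ellint a b"
proof -
  define f where "f b x = 1 / (sqrt (x\<^sup>2 + a\<^sup>2) * sqrt (x\<^sup>2 + b\<^sup>2))" for b x :: real
  have fi: "f b integrable_on {0<..}" if "b > 0" for b
    unfolding f_def by (intro set_lebesgue_integral_eq_integral(1) ellint_integrable a that)
  have cont: "continuous_on {0..1} (f b)" if "b > 0" for b
    unfolding f_def by (intro continuous_on_ellint_integrand a that)
  have le: "f b' x \<le> f b x" for x
    unfolding f_def by (intro ellint_integrand_antimono) (use assms in auto)
  have lt: "f b' x < f b x" for x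
    unfolding f_def
  proof (rule divide_strict_left_mono)
    have "b\<^sup>2 < b'\<^sup>2"
      using b by (intro power_strict_mono) auto
    then show "sqrt (x\<^sup>2 + a\<^sup>2) * sqrt (x\<^sup>2 + b\<^sup>2) < sqrt (x\<^sup>2 + a\<^sup>2) * sqrt (x\<^sup>2 + b'\<^sup>2)"
      using a by (intro mult_strict_left_mono) (auto intro!: add_nonneg_pos)
    show "0 < sqrt (x\<^sup>2 + a\<^sup>2) * sqrt (x\<^sup>2 + b'\<^sup>2) * (sqrt (x\<^sup>2 + a\<^sup>2) * sqrt (x\<^sup>2 + b\<^sup>2))"
      using assms by (intro mult_pos_pos) (auto intro!: add_nonneg_pos)
  qed auto
  have "integral {0..1} (f b') < integral {0..1} (f b)"
    using assms lt by (intro integral_less_real cont) auto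
  then have "0 < integral {0..1} (\<lambda>x. f b x - f b' x)"
    using assms cont by (subst integral_diff) (auto intro: integrable_continuous_real)
  also have "\<dots> = integral {0<..<1} (\<lambda>x. f b x - f b' x)"
    by (rule integral_open_interval_real)
  also have "\<dots> \<le> integral {0<..} (\<lambda>x. f b x - f b' x)"
  proof (rule integral_subset_le)
    show "(\<lambda>x. f b x - f b' x) integrable_on {0<..<1}"
      using assms cont by (subst integrable_on_Icc_iff_Ioo[symmetric])
        (auto intro!: integrable_continuous_real continuous_on_diff)
    show "(\<lambda>x. f b x - f b' x) integrable_on {0<..}"
      using assms by (intro integrable_diff fi) auto
  qed (use le in auto)
  also have "\<dots> = ellint a b - ellint a b'"
    unfolding ellint_def f_def[symmetric] using assms by (intro integral_diff fi) auto
  finally show ?thesis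
    by simp
qed

lemma ellint_pos:
  assumes "a > 0" "b > 0"
  shows "ellint a b > 0"
proof -
  define m where "m = max a b"
  have m: "m > 0" "a \<le> m" "b \<le> m"
    using assms by (auto simp: m_def)
  have "0 < ellint m m"
    using m by (simp add: ellint_diag)
  also have "\<dots> \<le> ellint a b"
    using m assms by (intro ellint_antimono)
  finally show ?thesis .
qed

lemma ellint_scale:
  assumes l: "l > 0" and "a > 0" "b > 0"
  shows "ellint (l * a) (l * b) = ellint a b / l"
proof -
  let ?f = "\<lambda>a b x::real. 1 / (sqrt (x\<^sup>2 + a\<^sup>2) * sqrt (x\<^sup>2 + b\<^sup>2))"
  have eq: "?f a b x / l = \<bar>l\<bar> * ?f (l * a) (l * b) (l * x)" if "x \<in> {0<..}" for x
  proof -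
    have *: "(l * x)\<^sup>2 + (l * a)\<^sup>2 = l\<^sup>2 * (x\<^sup>2 + a\<^sup>2)" for a
      by (simp add: algebra_simps power2_eq_square)
    show ?thesis
      unfolding * using l by (simp add: real_sqrt_mult)
  qed
  have img: "(\<lambda>x. l * x) ` {0<..} = {0<..}"
  proof (intro equalityI subsetI)
    fix y :: real assume "y \<in> {0<..}"
    then show "y \<in> (\<lambda>x. l * x) ` {0<..}"
      using l by (intro image_eqI[of _ _ "y / l"]) auto
  qed (use l in auto)
  have "integral {0<..} (\<lambda>x. ?f a b x / l) = integral {0<..} (?f (l * a) (l * b))"
    by (rule absolutely_integrable_substitution(2)[where g = "\<lambda>x. l * x" and g' = "\<lambda>_. l"
          and f = "?f (l * a) (l * b)", OF _ _ _ img eq])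
      (use assms in \<open>auto intro!: derivative_eq_intros ellint_integrable simp: inj_on_def\<close>)
  then show ?thesis
    unfolding ellint_def integral_divide by (rule sym)
qed

text \<open>The integrand is even. The whole line is needed because the substitution for the mean
  maps the half line onto it.\<close>

lemma ellint_whole_line:
  assumes "a > 0" "b > 0"
  shows "(\<lambda>x. 1 / (sqrt (x\<^sup>2 + a\<^sup>2) * sqrt (x\<^sup>2 + b\<^sup>2))) absolutely_integrable_on UNIV"
    and "integral UNIV (\<lambda>x. 1 / (sqrt (x\<^sup>2 + a\<^sup>2) * sqrt (x\<^sup>2 + b\<^sup>2))) = 2 * ellint a b"
proof -
  let ?f = "\<lambda>x::real. 1 / (sqrt (x\<^sup>2 + a\<^sup>2) * sqrt (x\<^sup>2 + b\<^sup>2))"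
  note pos = ellint_integrable[OF assms]
  have neg: "?f absolutely_integrable_on {..<0}" "integral {..<0} ?f = ellint a b"
    using has_absolute_integral_reflect_real[of "{..<0}" "{0<..}" ?f "ellint a b"] pos
    by (auto simp: ellint_def)
  have Un: "?f absolutely_integrable_on ({..<0} \<union> {0<..})"
    by (rule absolutely_integrable_Un) (use pos neg in auto)
  have null: "negligible (UNIV - ({..<0} \<union> {0::real<..}))"
    by (rule negligible_subset[of "{0}"]) auto
  show "?f absolutely_integrable_on UNIV"
    by (rule absolutely_integrable_spike_set[OF Un]) (auto intro: negligible_subset[OF null])
  have "integral UNIV ?f = integral ({..<0} \<union> {0<..}) ?f"
    by (rule integral_spike_set) (auto intro: negligible_subset[OF null])
  also have "\<dots> = integral {..<0} ?f + integral {0<..} ?f"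
  proof (rule integral_Un)
    have "{..<0} \<inter> {0::real<..} = {}"
      by auto
    then show "negligible ({..<0} \<inter> {0::real<..})"
      by simp
  qed (use pos neg in \<open>auto intro: set_lebesgue_integral_eq_integral(1)\<close>)
  also have "\<dots> = 2 * ellint a b"
    using neg by (simp add: ellint_def)
  finally show "integral UNIV ?f = 2 * ellint a b" .
qed

text \<open>The map \<open>x \<mapsto> (x - a * b / x) / 2\<close> is an increasing bijection from
  the half line onto the line. Adding \<open>a * b\<close> to its square gives the square of
  \<open>(x + a * b / x) / 2\<close>, and adding the square of the arithmetic mean gives
  \<open>(x^2 + a^2) * (x^2 + b^2) / (2 * x)^2\<close>. The first root cancels against the
  derivative, the second leaves the original integrand.\<close>

lemma ellint_agm:
  assumes a: "a > 0" and b: "b > 0"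
  shows "ellint ((a + b) / 2) (sqrt (a * b)) = ellint a b"
proof -
  let ?f = "\<lambda>a b x::real. 1 / (sqrt (x\<^sup>2 + a\<^sup>2) * sqrt (x\<^sup>2 + b\<^sup>2))"
  let ?A = "(a + b) / 2" and ?G = "sqrt (a * b)"
  let ?g = "\<lambda>x. (x - a * b / x) / 2"
  have ab: "a * b > 0"
    using assms by simp
  have AG: "?A > 0" "?G > 0"
    using assms by auto
  have der: "(?g has_field_derivative (1 + a * b / x\<^sup>2) / 2) (at x within {0<..})"
    if "x \<in> {0<..}" for x
    using that by (auto intro!: derivative_eq_intros simp: power2_eq_square)
  have less: "?g x < ?g y" if "0 < x" "x < y" for x y
  proof -
    have "a * b / y < a * b / x"
      using that ab by (intro divide_strict_left_mono) auto
    with that show ?thesis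
      by simp
  qed
  have inj: "inj_on ?g {0<..}"
    by (rule linorder_inj_onI) (use less in fastforce)+
  have "\<exists>x>0. y = ?g x" for y
  proof -
    \<comment> \<open>The preimage \<open>y + r\<close> is the positive root of
      \<open>x^2 - 2 * y * x - a * b = 0\<close>.\<close>
    define r where "r = sqrt (y\<^sup>2 + a * b)"
    have "\<bar>y\<bar> < r"
      unfolding r_def by (rule real_less_rsqrt) (use ab in auto)
    then have pos: "y + r > 0"
      by auto
    have "r\<^sup>2 = y\<^sup>2 + a * b"
      unfolding r_def using ab by (simp add: add_nonneg_nonneg)
    then have "a * b = (r - y) * (y + r)"
      by (simp add: power2_eq_square algebra_simps)
    then have "a * b / (y + r) = r - y"
      using pos by simp
    then show ?thesis
      using pos by (intro exI[of _ "y + r"]) auto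
  qed
  then have img: "?g ` {0<..} = UNIV"
    by (simp add: set_eq_iff image_iff Bex_def)
  have eq: "2 * ?f a b x = \<bar>(1 + a * b / x\<^sup>2) / 2\<bar> * ?f ?A ?G (?g x)" if "x \<in> {0<..}" for x
  proof -
    have x: "x > 0"
      using that by simp
    let ?P = "(x\<^sup>2 + a\<^sup>2) * (x\<^sup>2 + b\<^sup>2)"
    have "(?g x)\<^sup>2 + ?G\<^sup>2 = ((x\<^sup>2 + a * b) / (2 * x))\<^sup>2"
      using x ab by (simp add: field_simps power2_eq_square)
    then have G: "sqrt ((?g x)\<^sup>2 + ?G\<^sup>2) = (x\<^sup>2 + a * b) / (2 * x)"
      using x ab by (simp add: real_sqrt_unique)
    have "(?g x)\<^sup>2 + ?A\<^sup>2 = ?P / (2 * x)\<^sup>2"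
      using x by (simp add: field_simps power2_eq_square)
    then have A: "sqrt ((?g x)\<^sup>2 + ?A\<^sup>2) = sqrt ?P / (2 * x)"
      using x by (simp add: real_sqrt_divide real_sqrt_mult)
    have D: "\<bar>(1 + a * b / x\<^sup>2) / 2\<bar> = (x\<^sup>2 + a * b) / (2 * x\<^sup>2)"
      using x ab by (simp add: field_simps)
    have "x\<^sup>2 + a * b \<noteq> 0"
      using x ab by (smt (verit) zero_le_power2)
    moreover have "d / (2 * x\<^sup>2) * (1 / (r / (2 * x) * (d / (2 * x)))) = 2 / r" if "d \<noteq> 0" for d r
      using that x by (simp add: power2_eq_square)
    ultimately show ?thesis
      unfolding A G D by (simp add: real_sqrt_mult)
  qed
  \<comment> \<open>The factor 2 carried by \<open>eq\<close> is matched by the factor 2 between the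
    whole line and the half line.\<close>
  have "2 * ellint a b = integral {0<..} (\<lambda>x. 2 * ?f a b x)"
    unfolding ellint_def by (rule integral_mult_right[symmetric])
  also have "\<dots> = integral UNIV (?f ?A ?G)"
    by (rule absolutely_integrable_substitution(2)[OF _ der inj img eq ellint_whole_line(1)[OF AG]])
      auto
  also have "\<dots> = 2 * ellint ?A ?G"
    by (rule ellint_whole_line(2)[OF AG])
  finally show ?thesis
    by simp
qed

text \<open>The substitution is \<open>t = 1 / sqrt (1 + x^2)\<close>. It sends the singular
  endpoint \<open>t = 1\<close> to \<open>x = 0\<close>, where the new integrand is bounded; the map
  reverses orientation, hence the absolute value of the derivative.\<close>

lemma elliptic_K_eq_ellint:
  assumes k: "k \<in> {0<..<1}"
  shows "elliptic_K k = ellint 1 (sqrt (1 - k\<^sup>2))"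
proof -
  let ?k' = "sqrt (1 - k\<^sup>2)"
  let ?f = "\<lambda>x::real. 1 / (sqrt (x\<^sup>2 + 1\<^sup>2) * sqrt (x\<^sup>2 + ?k'\<^sup>2))"
  let ?g = "\<lambda>t::real. sqrt (1 / t\<^sup>2 - 1)"
  have k2: "k\<^sup>2 < 1" "k\<^sup>2 > 0"
    using k by (auto simp: power_less_one_iff abs_square_less_1)
  have t2: "t\<^sup>2 < 1" "t\<^sup>2 > 0" "1 / t\<^sup>2 > 1" if "t \<in> {0<..<1}" for t :: real
    using that by (auto simp: power_less_one_iff abs_square_less_1)
  have der: "(?g has_field_derivative - 1 / (t ^ 3 * ?g t)) (at t within {0<..<1})"
    if "t \<in> {0<..<1}" for t
    using that t2[OF that]
    by (auto intro!: derivative_eq_intros simp: field_simps power2_eq_square power3_eq_cube)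
  have inj: "inj_on ?g {0<..<1}"
    by (rule inj_onI) (auto simp: power2_eq_iff)
  have img: "?g ` {0<..<1} = {0<..}"
  proof (intro equalityI subsetI)
    fix y :: real assume y: "y \<in> {0<..}"
    have "y = ?g (1 / sqrt (1 + y\<^sup>2))"
      using y by (simp add: power_divide add_nonneg_nonneg)
    moreover have "1 / sqrt (1 + y\<^sup>2) \<in> {0<..<1}"
      using y by (simp add: add_pos_nonneg)
    ultimately show "y \<in> ?g ` {0<..<1}"
      by (rule image_eqI)
  qed (use t2 in force)
  have eq: "1 / (sqrt (1 - t\<^sup>2) * sqrt (1 - k\<^sup>2 * t\<^sup>2)) = \<bar>- 1 / (t ^ 3 * ?g t)\<bar> * ?f (?g t)"
    if "t \<in> {0<..<1}" for t
  proof -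
    note t = t2[OF that]
    have t0: "t > 0"
      using that by simp
    have "1 / t\<^sup>2 - 1 = (1 - t\<^sup>2) / t\<^sup>2"
      using t by (simp add: field_simps)
    then have g: "?g t = sqrt (1 - t\<^sup>2) / t"
      using t0 by (simp add: real_sqrt_divide)
    have "(?g t)\<^sup>2 + 1\<^sup>2 = 1 / t\<^sup>2" "(?g t)\<^sup>2 + ?k'\<^sup>2 = (1 - k\<^sup>2 * t\<^sup>2) / t\<^sup>2"
      using t k2 by (simp_all add: field_simps)
    then have f: "?f (?g t) = t\<^sup>2 / sqrt (1 - k\<^sup>2 * t\<^sup>2)"
      using t0 by (simp add: real_sqrt_divide power2_eq_square)
    show ?thesis
      unfolding f unfolding g using t0 t
      by (simp add: abs_mult power2_eq_square power3_eq_cube)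
  qed
  have "elliptic_K k = integral {0<..<1} (\<lambda>t. 1 / (sqrt (1 - t\<^sup>2) * sqrt (1 - k\<^sup>2 * t\<^sup>2)))"
    unfolding elliptic_K_def by (rule integral_open_interval_real)
  also have "\<dots> = integral {0<..} ?f"
    by (rule absolutely_integrable_substitution(2)[OF _ der inj img eq ellint_integrable])
      (use k2 in auto)
  finally show ?thesis
    by (simp add: ellint_def)
qed

text \<open>The involution \<open>x \<mapsto> \<kappa> / x\<close> preserves the integrand and swaps the two halves.\<close>

lemma ellint_split:
  assumes kappa: "\<kappa> > 0"
  shows "ellint 1 \<kappa> = 2 * integral {0..sqrt \<kappa>} (\<lambda>x. 1 / (sqrt (x\<^sup>2 + 1\<^sup>2) * sqrt (x\<^sup>2 + \<kappa>\<^sup>2)))"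
proof -
  let ?f = "\<lambda>x::real. 1 / (sqrt (x\<^sup>2 + 1\<^sup>2) * sqrt (x\<^sup>2 + \<kappa>\<^sup>2))"
  let ?s = "sqrt \<kappa>" and ?g = "\<lambda>x. \<kappa> / x"
  have s: "?s > 0" "?s * ?s = \<kappa>"
    using kappa by auto
  have ai: "?f absolutely_integrable_on {0<..}"
    by (rule ellint_integrable) (use kappa in auto)
  have aiT: "?f absolutely_integrable_on {?s<..}"
    by (rule set_integrable_subset[OF ai]) (use s in auto)
  have der: "(?g has_field_derivative - \<kappa> / x\<^sup>2) (at x within {0<..<?s})" if "x \<in> {0<..<?s}" for x
    using that by (auto intro!: derivative_eq_intros simp: power2_eq_square)
  have inj: "inj_on ?g {0<..<?s}"
    using kappa by (auto simp: inj_on_def field_simps)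
  have img: "?g ` {0<..<?s} = {?s<..}"
  proof (intro equalityI subsetI)
    fix y assume "y \<in> {?s<..}"
    then have y: "y > ?s"
      by simp
    with s have "y > 0"
      by linarith
    from y s have "?s * ?s < ?s * y"
      by (intro mult_strict_left_mono)
    with s \<open>y > 0\<close> have "\<kappa> / y < ?s"
      by (simp add: field_simps)
    then show "y \<in> ?g ` {0<..<?s}"
      using \<open>y > 0\<close> kappa by (intro image_eqI[of _ _ "\<kappa> / y"]) auto
  next
    fix y assume "y \<in> ?g ` {0<..<?s}"
    then obtain x where x: "0 < x" "x < ?s" "y = \<kappa> / x"
      by auto
    have "x * ?s < ?s * ?s"
      using x s by (intro mult_strict_right_mono)
    also have "\<dots> = x * y"
      using x s by simp
    finally show "y \<in> {?s<..}"
      using x(1) by (simp only: mult_less_cancel_left_pos greaterThan_iff)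
  qed
  have eq: "?f x = \<bar>- \<kappa> / x\<^sup>2\<bar> * ?f (?g x)" if "x \<in> {0<..<?s}" for x
  proof -
    have x: "x > 0"
      using that by simp
    have "(?g x)\<^sup>2 + 1\<^sup>2 = (x\<^sup>2 + \<kappa>\<^sup>2) / x\<^sup>2" "(?g x)\<^sup>2 + \<kappa>\<^sup>2 = \<kappa>\<^sup>2 * (x\<^sup>2 + 1\<^sup>2) / x\<^sup>2"
      using x by (simp_all add: field_simps power2_eq_square)
    then have "?f (?g x) = x\<^sup>2 / \<kappa> * ?f x"
      using x kappa by (simp add: real_sqrt_divide real_sqrt_mult power2_eq_square)
    then show ?thesis
      using x kappa by simp
  qed
  have half: "integral {0<..<?s} ?f = integral {?s<..} ?f"
    by (rule absolutely_integrable_substitution(2)[OF _ der inj img eq aiT]) auto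
  have Un: "{0<..<?s} \<union> {?s<..} = {0<..} - {?s}"
    using order.strict_trans[OF s(1)] by (force simp del: real_sqrt_gt_0_iff)
  have "ellint 1 \<kappa> = integral ({0<..<?s} \<union> {?s<..}) ?f"
    unfolding ellint_def Un
    by (rule integral_spike_set; rule negligible_subset[of "{?s}"]) auto
  also have "\<dots> = integral {0<..<?s} ?f + integral {?s<..} ?f"
  proof (rule integral_Un)
    show "?f integrable_on {0<..<?s}"
      by (rule set_lebesgue_integral_eq_integral(1), rule set_integrable_subset[OF ai]) auto
    show "?f integrable_on {?s<..}"
      using aiT by (rule set_lebesgue_integral_eq_integral(1))
    have "{0<..<?s} \<inter> {?s<..} = {}"
      by auto
    then show "negligible ({0<..<?s} \<inter> {?s<..})"
      by simp
  qed
  also have "\<dots> = 2 * integral {0..?s} ?f"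
    unfolding half[symmetric] integral_open_interval_real by simp
  finally show ?thesis .
qed

section \<open>Logarithmic growth of the integral as one argument tends to 0\<close>

lemma integral_inverse_sqrt:
  assumes kappa: "\<kappa> > 0" and s: "s \<ge> 0"
  shows "((\<lambda>x. 1 / sqrt (x\<^sup>2 + \<kappa>\<^sup>2)) has_integral arsinh (s / \<kappa>)) {0..s}"
proof -
  have "((\<lambda>x. arsinh (x / \<kappa>)) has_real_derivative 1 / sqrt (x\<^sup>2 + \<kappa>\<^sup>2)) (at x within {0..s})" for x
  proof -
    have "(x / \<kappa>)\<^sup>2 + 1 = (x\<^sup>2 + \<kappa>\<^sup>2) / \<kappa>\<^sup>2"
      using kappa by (simp add: field_simps)
    then have "sqrt ((x / \<kappa>)\<^sup>2 + 1) = sqrt (x\<^sup>2 + \<kappa>\<^sup>2) / \<kappa>"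
      using kappa by (simp add: real_sqrt_divide)
    moreover have "((\<lambda>x. arsinh (x / \<kappa>)) has_real_derivative 1 / sqrt ((x / \<kappa>)\<^sup>2 + 1) * (1 / \<kappa>))
        (at x within {0..s})"
      by (rule DERIV_chain2[OF arsinh_real_has_field_derivative])
        (use kappa in \<open>auto intro!: derivative_eq_intros\<close>)
    ultimately show ?thesis
      using kappa by simp
  qed
  then have "((\<lambda>x. 1 / sqrt (x\<^sup>2 + \<kappa>\<^sup>2)) has_integral arsinh (s / \<kappa>) - arsinh (0 / \<kappa>)) {0..s}"
    by (intro fundamental_theorem_of_calculus s) (simp add: has_real_derivative_iff_has_vector_derivative)
  then show ?thesis
    by simp
qed

text \<open>Splitting at the fixed point \<open>sqrt \<kappa>\<close> of the involution pays off
  here: below it \<open>x^2 \<le> \<kappa>\<close>, so the factor \<open>sqrt (x^2 + 1)\<close>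
  stays between 1 and \<open>sqrt (1 + \<kappa>)\<close>, and what remains has an elementary
  antiderivative.\<close>

lemma ellint_bounds:
  assumes kappa: "\<kappa> > 0"
  shows "2 * arsinh (1 / sqrt \<kappa>) / sqrt (1 + \<kappa>) \<le> ellint 1 \<kappa>"
    and "ellint 1 \<kappa> \<le> 2 * arsinh (1 / sqrt \<kappa>)"
proof -
  let ?f = "\<lambda>x::real. 1 / (sqrt (x\<^sup>2 + 1\<^sup>2) * sqrt (x\<^sup>2 + \<kappa>\<^sup>2))"
  let ?s = "sqrt \<kappa>" and ?h = "\<lambda>x. 1 / sqrt (x\<^sup>2 + \<kappa>\<^sup>2)"
  have "?s / \<kappa> = 1 / ?s"
    using kappa by (simp add: field_simps)
  then have h: "(?h has_integral arsinh (1 / ?s)) {0..?s}"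
    using integral_inverse_sqrt[OF kappa, of ?s] kappa by simp
  have f: "(?f has_integral ellint 1 \<kappa> / 2) {0..?s}"
    using ellint_split[OF kappa] kappa
    by (simp add: has_integral_integral[symmetric] integrable_continuous_real
        continuous_on_ellint_integrand[of 1 \<kappa>, simplified])
  have le: "?h x / sqrt (1 + \<kappa>) \<le> ?f x" "?f x \<le> ?h x" if "x \<in> {0..?s}" for x
  proof -
    have "x\<^sup>2 \<le> \<kappa>"
      using that kappa by (metis atLeastAtMost_iff power_mono real_sqrt_pow2 less_imp_le)
    then have 1: "1 / sqrt (1 + \<kappa>) \<le> 1 / sqrt (x\<^sup>2 + 1)"
      by (intro divide_left_mono) (auto intro!: mult_pos_pos add_nonneg_pos simp: kappa add_pos_pos)
    have 2: "1 / sqrt (x\<^sup>2 + 1) \<le> 1"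
      by (simp add: add_nonneg_pos)
    have 3: "?f x = 1 / sqrt (x\<^sup>2 + 1) * ?h x" "?h x / sqrt (1 + \<kappa>) = 1 / sqrt (1 + \<kappa>) * ?h x"
      by simp_all
    show "?h x / sqrt (1 + \<kappa>) \<le> ?f x"
      unfolding 3 by (intro mult_right_mono 1) auto
    show "?f x \<le> ?h x"
      unfolding 3 using mult_right_mono[OF 2, of "?h x"] by simp
  qed
  have "arsinh (1 / ?s) / sqrt (1 + \<kappa>) \<le> ellint 1 \<kappa> / 2"
    by (rule has_integral_le[OF has_integral_divide[OF h] f]) (rule le)
  then show "2 * arsinh (1 / ?s) / sqrt (1 + \<kappa>) \<le> ellint 1 \<kappa>"
    by (simp add: mult.commute)
  have "ellint 1 \<kappa> / 2 \<le> arsinh (1 / ?s)"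
    by (rule has_integral_le[OF f h]) (rule le)
  then show "ellint 1 \<kappa> \<le> 2 * arsinh (1 / ?s)"
    by simp
qed

text \<open>As \<open>2 * arsinh (1 / sqrt \<kappa>)\<close> is
  \<open>- ln \<kappa> + 2 * ln 2\<close> up to a vanishing error, both bounds have the same leading
  term. The additive constant disappears in the quotient.\<close>

lemma ellint_asymptotic: "((\<lambda>\<kappa>. ellint 1 \<kappa> / (- ln \<kappa>)) \<longlongrightarrow> 1) (at_right 0)"
proof (rule tendsto_sandwich)
  show "\<forall>\<^sub>F \<kappa> in at_right 0. 2 * arsinh (1 / sqrt \<kappa>) / sqrt (1 + \<kappa>) / (- ln \<kappa>) \<le> ellint 1 \<kappa> / (- ln \<kappa>)"
    using eventually_at_right_real[OF zero_less_one]
    by eventually_elim (rule divide_right_mono, rule ellint_bounds, auto)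
  show "\<forall>\<^sub>F \<kappa> in at_right 0. ellint 1 \<kappa> / (- ln \<kappa>) \<le> 2 * arsinh (1 / sqrt \<kappa>) / (- ln \<kappa>)"
    using eventually_at_right_real[OF zero_less_one]
    by eventually_elim (rule divide_right_mono, rule ellint_bounds, auto)
  show "((\<lambda>\<kappa>::real. 2 * arsinh (1 / sqrt \<kappa>) / sqrt (1 + \<kappa>) / (- ln \<kappa>)) \<longlongrightarrow> 1) (at_right 0)"
    unfolding arsinh_real_def by real_asymp
  show "((\<lambda>\<kappa>::real. 2 * arsinh (1 / sqrt \<kappa>) / (- ln \<kappa>)) \<longlongrightarrow> 1) (at_right 0)"
    unfolding arsinh_real_def by real_asymp
qed

section \<open>Theta constants\<close>

lemma nonneg_summable_on_comparison:
  fixes f g :: "'a \<Rightarrow> real"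
  assumes g: "g summable_on A" and f: "\<And>x. x \<in> A \<Longrightarrow> 0 \<le> f x" "\<And>x. x \<in> A \<Longrightarrow> f x \<le> g x"
  shows "f summable_on A"
proof (rule Infinite_Sum.abs_summable_summable)
  have "(\<lambda>x. norm (g x)) summable_on A"
    using g summable_on_iff_abs_summable_on_real by blast
  moreover have "norm (f x) \<le> norm (g x)" if "x \<in> A" for x
    using f[OF that] by simp
  ultimately show "(\<lambda>x. norm (f x)) summable_on A"
    by (rule Infinite_Sum.abs_summable_on_comparison_test)
qed

lemma
  fixes f :: "'a \<Rightarrow> real" and g :: "'b \<Rightarrow> real"
  assumes f: "f summable_on UNIV" "\<And>x. 0 \<le> f x" and g: "g summable_on UNIV" "\<And>x. 0 \<le> g x"
  shows summable_on_product: "(\<lambda>p. f (fst p) * g (snd p)) summable_on UNIV"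
    and infsum_product: "(\<Sum>\<^sub>\<infinity>p. f (fst p) * g (snd p)) = infsum f UNIV * infsum g UNIV"
proof -
  have *: "(\<lambda>p. norm (f (fst p) * g (snd p))) summable_on UNIV \<times> UNIV"
    unfolding Infinite_Sum.abs_summable_on_Sigma_iff
    using f g by (auto simp: abs_mult infsum_cmult_right infsum_nonneg
        intro!: summable_on_cmult_right summable_on_cmult_left)
  then show sum: "(\<lambda>p. f (fst p) * g (snd p)) summable_on UNIV"
    unfolding UNIV_Times_UNIV by (rule Infinite_Sum.abs_summable_summable)
  then have "(\<Sum>\<^sub>\<infinity>p. f (fst p) * g (snd p)) = (\<Sum>\<^sub>\<infinity>x. \<Sum>\<^sub>\<infinity>y. f x * g y)"
    using infsum_Sigma_banach[of "\<lambda>p. f (fst p) * g (snd p)" UNIV "\<lambda>_. UNIV"] by simp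
  also have "\<dots> = infsum f UNIV * infsum g UNIV"
    using f g by (simp add: infsum_cmult_right infsum_cmult_left)
  finally show "(\<Sum>\<^sub>\<infinity>p. f (fst p) * g (snd p)) = infsum f UNIV * infsum g UNIV" .
qed

lemma inj_parity_even: "inj (\<lambda>(u, v). (u + v, u - v :: int))"
  by (auto simp: inj_def)

lemma inj_parity_odd: "inj (\<lambda>(u, v). (u + v + 1, u - v :: int))"
  by (auto simp: inj_def)

lemma range_parity_even: "range (\<lambda>(u, v). (u + v, u - v :: int)) = {(m, n). even (m + n)}"
proof (intro equalityI subsetI)
  fix p :: "int \<times> int" assume "p \<in> {(m, n). even (m + n)}"
  then obtain m n where p: "p = (m, n)" "even (m + n)"
    by auto
  then obtain u where "m + n = 2 * u"
    by (elim evenE)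
  then have "p = (\<lambda>(u, v). (u + v, u - v)) (u, m - u)"
    using p by simp
  then show "p \<in> range (\<lambda>(u, v). (u + v, u - v))"
    by blast
qed auto

lemma range_parity_odd: "range (\<lambda>(u, v). (u + v + 1, u - v :: int)) = {(m, n). odd (m + n)}"
proof (intro equalityI subsetI)
  fix p :: "int \<times> int" assume "p \<in> {(m, n). odd (m + n)}"
  then obtain m n where p: "p = (m, n)" "odd (m + n)"
    by auto
  then obtain u where "m + n = 2 * u + 1"
    by (elim oddE)
  then have "p = (\<lambda>(u, v). (u + v + 1, u - v)) (u, m - u - 1)"
    using p by simp
  then show "p \<in> range (\<lambda>(u, v). (u + v + 1, u - v))"
    by blast
qed auto

lemma infsum_parity_split:
  fixes f :: "int \<times> int \<Rightarrow> real"
  assumes "f summable_on UNIV"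
  shows "infsum f UNIV = (\<Sum>\<^sub>\<infinity>p. f (fst p + snd p, fst p - snd p)) +
    (\<Sum>\<^sub>\<infinity>p. f (fst p + snd p + 1, fst p - snd p))"
proof -
  have UN: "UNIV = {(m, n :: int). even (m + n)} \<union> {(m, n). odd (m + n)}"
    by auto
  have "infsum f UNIV = infsum f {(m, n). even (m + n)} + infsum f {(m, n). odd (m + n)}"
    by (subst UN, rule infsum_Un_disjoint)
      (auto intro: summable_on_subset_banach[OF assms])
  also have "infsum f {(m, n). even (m + n)} = (\<Sum>\<^sub>\<infinity>p. f (fst p + snd p, fst p - snd p))"
    unfolding range_parity_even[symmetric] infsum_reindex[OF inj_parity_even]
    by (simp add: case_prod_unfold o_def)
  also have "infsum f {(m, n). odd (m + n)} = (\<Sum>\<^sub>\<infinity>p. f (fst p + snd p + 1, fst p - snd p))"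
    unfolding range_parity_odd[symmetric] infsum_reindex[OF inj_parity_odd]
    by (simp add: case_prod_unfold o_def)
  finally show ?thesis .
qed

lemma summable_on_powr_abs:
  fixes q :: real
  assumes "0 < q" "q < 1"
  shows "(\<lambda>n::int. q powr \<bar>of_int n\<bar>) summable_on UNIV"
proof -
  let ?f = "\<lambda>n::int. q powr \<bar>of_int n\<bar>"
  have geo: "(\<lambda>n. q ^ n) summable_on UNIV"
    using assms by (intro norm_summable_imp_summable_on) (simp add: summable_geometric)
  have pos: "?f summable_on range int"
    using geo assms by (subst summable_on_reindex) (auto simp: o_def powr_realpow)
  \<comment> \<open>The negative integers are indexed as \<open>- m - 1\<close>, so that 0 is
    counted only among the nonnegative ones.\<close>
  have inj: "inj (\<lambda>m. - int m - 1)"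
    by (auto simp: inj_def)
  have "(\<lambda>n. q * q ^ n) summable_on UNIV"
    by (rule summable_on_cmult_right[OF geo])
  moreover have "?f (- int m - 1) = q * q ^ m" for m
  proof -
    have "\<bar>real_of_int (- int m - 1)\<bar> = real (Suc m)"
      by simp
    then show ?thesis
      using assms by (simp only: powr_realpow power_Suc)
  qed
  ultimately have neg: "?f summable_on range (\<lambda>m. - int m - 1)"
    by (subst summable_on_reindex[OF inj]) (simp add: o_def)
  have UN: "UNIV = range int \<union> range (\<lambda>m. - int m - 1)"
  proof -
    have "n \<in> range int \<union> range (\<lambda>m. - int m - 1)" for n
    proof (cases "n \<ge> 0")
      case True
      then have "n = int (nat n)" by simp
      then show ?thesis by blast
    next
      case False
      then have "n = - int (nat (- n - 1)) - 1" by simp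
      then show ?thesis by blast
    qed
    then show ?thesis by auto
  qed
  show ?thesis
    by (subst UN, rule summable_on_Un_disjoint[OF pos neg]) auto
qed

text \<open>One family covers both theta constants, with shifts 0 and 1/2. The general shift is
  useful because squaring at shift 1/2 produces shift 1, which periodicity brings back to 0.\<close>

definition theta_shift :: "real \<Rightarrow> real \<Rightarrow> real" where
  "theta_shift h q = (\<Sum>\<^sub>\<infinity>n::int. q powr ((of_int n + h)\<^sup>2))"

lemma theta3_eq_theta_shift: "theta3 = theta_shift 0"
  by (simp add: fun_eq_iff theta3_def theta_shift_def)

lemma theta2_eq_theta_shift: "theta2 = theta_shift (1 / 2)"
  by (simp add: fun_eq_iff theta2_def theta_shift_def)

lemma theta_shift_summable:
  fixes q h :: real
  assumes q: "0 < q" "q < 1"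
  shows "(\<lambda>n::int. q powr ((of_int n + h)\<^sup>2)) summable_on UNIV"
proof (rule nonneg_summable_on_comparison)
  show "(\<lambda>n::int. q powr \<bar>of_int n\<bar> * q powr (- \<bar>h\<bar> - 1)) summable_on UNIV"
    by (intro summable_on_cmult_left summable_on_powr_abs q)
  fix n :: int
  \<comment> \<open>This gives \<open>\<bar>x\<bar> - 1/4 \<le> x^2\<close>, weakened to
    \<open>\<bar>x\<bar> - 1\<close>. Since \<open>q < 1\<close>, a lower bound on the exponent is
    an upper bound on the term, here a geometric one.\<close>
  have "0 \<le> (\<bar>of_int n + h\<bar> - 1 / 2)\<^sup>2"
    by simp
  then have "\<bar>of_int n + h\<bar> - 1 \<le> (of_int n + h)\<^sup>2"
    by (simp add: power2_diff power_divide)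
  then have "\<bar>of_int n\<bar> - \<bar>h\<bar> - 1 \<le> (of_int n + h)\<^sup>2"
    by linarith
  then show "q powr ((of_int n + h)\<^sup>2) \<le> q powr \<bar>of_int n\<bar> * q powr (- \<bar>h\<bar> - 1)"
    unfolding powr_add[symmetric] using q by (intro powr_mono') auto
qed auto

lemma theta_shift_pos:
  assumes "0 < q" "q < 1"
  shows "theta_shift h q > 0"
proof -
  have "0 < q powr (h\<^sup>2)"
    using assms by simp
  also have "\<dots> \<le> theta_shift h q"
    unfolding theta_shift_def
    using finite_sum_le_infsum[OF theta_shift_summable[OF assms, of h], of "{0}"] by simp
  finally show ?thesis .
qed

lemma theta_shift_periodic: "theta_shift (h + 1) q = theta_shift h q"
proof -
  have "bij (\<lambda>n::int. n + 1)"
    by (rule bij_plus_right)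
  from infsum_reindex_bij_betw[OF this, of "\<lambda>n. q powr ((of_int n + h)\<^sup>2)"] show ?thesis
    by (simp add: theta_shift_def algebra_simps)
qed

lemma theta_shift_product:
  assumes q: "0 < q" "q < 1"
  shows "theta_shift h q * theta_shift h' q =
    (\<Sum>\<^sub>\<infinity>p::int \<times> int. q powr ((of_int (fst p) + h)\<^sup>2 + (of_int (snd p) + h')\<^sup>2))"
  unfolding theta_shift_def powr_add
  by (rule infsum_product[symmetric]) (auto intro: theta_shift_summable q)

text \<open>The sum of two squares is half the square of the sum plus half the square of the
  difference. With shift \<open>h\<close> in both coordinates the sum carries \<open>2 * h\<close>
  and the difference nothing, so \<open>h\<close> survives in only one factor of each product; the
  odd class adds 1/2 to both factors.\<close>

lemma theta_shift_square:
  assumes q: "0 < q" "q < 1"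
  shows "(theta_shift h q)\<^sup>2 = theta_shift h (q\<^sup>2) * theta_shift 0 (q\<^sup>2) +
    theta_shift (h + 1 / 2) (q\<^sup>2) * theta_shift (1 / 2) (q\<^sup>2)"
proof -
  let ?f = "\<lambda>p::int \<times> int. q powr ((of_int (fst p) + h)\<^sup>2 + (of_int (snd p) + h)\<^sup>2)"
  have q2: "0 < q\<^sup>2" "q\<^sup>2 < 1"
    using q by (auto simp: power_less_one_iff abs_square_less_1)
  have sum: "?f summable_on UNIV"
    unfolding powr_add by (rule summable_on_product) (auto intro: theta_shift_summable q)
  have pw: "(q\<^sup>2) powr x = q powr (2 * x)" for x
    using q by (simp add: powr_powr flip: powr_numeral)
  have "(theta_shift h q)\<^sup>2 = infsum ?f UNIV"
    unfolding power2_eq_square[of "theta_shift h q"] by (rule theta_shift_product[OF q])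
  also have "\<dots> = (\<Sum>\<^sub>\<infinity>p. ?f (fst p + snd p, fst p - snd p)) +
    (\<Sum>\<^sub>\<infinity>p. ?f (fst p + snd p + 1, fst p - snd p))"
    by (rule infsum_parity_split[OF sum])
  also have "(\<Sum>\<^sub>\<infinity>p. ?f (fst p + snd p, fst p - snd p)) = theta_shift h (q\<^sup>2) * theta_shift 0 (q\<^sup>2)"
    unfolding theta_shift_product[OF q2] pw
    by (intro infsum_cong arg_cong[where f = "(powr) q"]) (simp add: power2_eq_square algebra_simps)
  also have "(\<Sum>\<^sub>\<infinity>p. ?f (fst p + snd p + 1, fst p - snd p)) =
    theta_shift (h + 1 / 2) (q\<^sup>2) * theta_shift (1 / 2) (q\<^sup>2)"
    unfolding theta_shift_product[OF q2] pw
    by (intro infsum_cong arg_cong[where f = "(powr) q"]) (simp add: power2_eq_square field_simps)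
  finally show ?thesis .
qed

lemma theta_pos:
  assumes "0 < q" "q < 1"
  shows "theta3 q > 0" "theta2 q > 0"
  using theta_shift_pos[OF assms] by (simp_all add: theta3_eq_theta_shift theta2_eq_theta_shift)

lemma theta3_square:
  assumes "0 < q" "q < 1"
  shows "(theta3 q)\<^sup>2 = (theta3 (q\<^sup>2))\<^sup>2 + (theta2 (q\<^sup>2))\<^sup>2"
  using theta_shift_square[OF assms, of 0]
  by (simp add: theta3_eq_theta_shift theta2_eq_theta_shift power2_eq_square)

text \<open>At shift 1/2 the even class gives shifts 1/2 and 0, the odd class 1 and 1/2; by
  periodicity the two contributions coincide, whence the factor 2.\<close>

lemma theta2_square:
  assumes "0 < q" "q < 1"
  shows "(theta2 q)\<^sup>2 = 2 * theta2 (q\<^sup>2) * theta3 (q\<^sup>2)"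
  using theta_shift_square[OF assms, of "1 / 2"] theta_shift_periodic[of 0]
  by (simp add: theta3_eq_theta_shift theta2_eq_theta_shift)

section \<open>Theta constants as the nome tends to 0\<close>

text \<open>Each index in \<open>A\<close> contributes exactly 1. Elsewhere the exponent is at least
  1, so for \<open>q < 1/2\<close> a term is at most \<open>2 * q\<close> times the term at the
  reference nome 1/2, and the tail is of order \<open>q\<close>.\<close>

lemma infsum_powr_tendsto_card:
  fixes e :: "'a \<Rightarrow> real"
  assumes A: "finite A" "\<And>n. n \<in> A \<Longrightarrow> e n = 0" and e: "\<And>n. n \<notin> A \<Longrightarrow> e n \<ge> 1"
    and sum: "(\<lambda>n. (1 / 2) powr e n) summable_on UNIV"
  shows "((\<lambda>q. \<Sum>\<^sub>\<infinity>n. q powr e n) \<longlongrightarrow> card A) (at_right 0)"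
proof (rule tendsto_sandwich)
  let ?C = "\<Sum>\<^sub>\<infinity>n\<in>-A. (1 / 2) powr e n"
  have le: "q powr e n \<le> 2 * q * (1 / 2) powr e n" if "q \<in> {0<..<1 / 2}" "n \<notin> A" for q n
  proof -
    have "q powr e n = (2 * q) powr e n * (1 / 2) powr e n"
      using that by (subst powr_mult[symmetric]) auto
    also have "\<dots> \<le> (2 * q) powr 1 * (1 / 2) powr e n"
      using that e by (intro mult_right_mono powr_mono') auto
    finally show ?thesis
      using that by simp
  qed
  have sumA: "(\<lambda>n. (1 / 2) powr e n) summable_on -A"
    by (rule summable_on_subset_banach[OF sum]) auto
  have sumq: "(\<lambda>n. q powr e n) summable_on -A" if "q \<in> {0<..<1 / 2}" for q
    by (rule nonneg_summable_on_comparison[OF summable_on_cmult_right[OF sumA, of "2 * q"]])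
      (use le that in auto)
  have split: "(\<Sum>\<^sub>\<infinity>n. q powr e n) = card A + (\<Sum>\<^sub>\<infinity>n\<in>-A. q powr e n)" if "q \<in> {0<..<1 / 2}" for q
  proof -
    have "(\<Sum>\<^sub>\<infinity>n. q powr e n) = (\<Sum>\<^sub>\<infinity>n\<in>A \<union> -A. q powr e n)"
      by simp
    also have "\<dots> = (\<Sum>\<^sub>\<infinity>n\<in>A. q powr e n) + (\<Sum>\<^sub>\<infinity>n\<in>-A. q powr e n)"
      by (rule infsum_Un_disjoint) (use A sumq[OF that] in auto)
    also have "(\<Sum>\<^sub>\<infinity>n\<in>A. q powr e n) = card A"
      using A that by simp
    finally show ?thesis .
  qed
  have ev: "\<forall>\<^sub>F q in at_right 0. q \<in> {0<..<1 / 2 :: real}"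
    by (rule eventually_at_right_real) simp
  show "\<forall>\<^sub>F q in at_right 0. real (card A) \<le> (\<Sum>\<^sub>\<infinity>n. q powr e n)"
    using ev by eventually_elim (auto simp: split intro!: infsum_nonneg)
  show "\<forall>\<^sub>F q in at_right 0. (\<Sum>\<^sub>\<infinity>n. q powr e n) \<le> card A + 2 * q * ?C"
    using ev
  proof eventually_elim
    case (elim q)
    have "(\<Sum>\<^sub>\<infinity>n\<in>-A. q powr e n) \<le> (\<Sum>\<^sub>\<infinity>n\<in>-A. 2 * q * (1 / 2) powr e n)"
      by (intro infsum_mono sumq summable_on_cmult_right sumA elim le) auto
    also have "\<dots> = 2 * q * ?C"
      by (rule infsum_cmult_right) (rule sumA)
    finally show ?case
      by (simp add: split[OF elim])
  qed
  have "((\<lambda>q. card A + 2 * q * ?C) \<longlongrightarrow> card A + 2 * 0 * ?C) (at_right 0)"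
    by (intro tendsto_intros)
  then show "((\<lambda>q. card A + 2 * q * ?C) \<longlongrightarrow> card A) (at_right 0)"
    by simp
qed simp

lemma theta3_tendsto: "(theta3 \<longlongrightarrow> 1) (at_right 0)"
proof -
  have "1 \<le> (real_of_int n)\<^sup>2" if "n \<notin> {0}" for n
  proof -
    have "1 \<le> \<bar>real_of_int n\<bar>"
      using that by auto
    then show ?thesis
      using abs_le_square_iff[of 1 "real_of_int n"] by simp
  qed
  then have "((\<lambda>q. \<Sum>\<^sub>\<infinity>n::int. q powr ((of_int n)\<^sup>2)) \<longlongrightarrow> card {0::int}) (at_right 0)"
    using theta_shift_summable[of "1 / 2" 0] by (intro infsum_powr_tendsto_card) auto
  then show ?thesis
    by (simp add: theta3_def[abs_def])
qed

lemma theta2_eq: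
  assumes q: "q > 0"
  shows "theta2 q = q powr (1 / 4) * (\<Sum>\<^sub>\<infinity>n::int. q powr ((of_int n)\<^sup>2 + of_int n))"
proof -
  have "(of_int n + 1 / 2)\<^sup>2 = 1 / 4 + ((of_int n)\<^sup>2 + of_int n :: real)" for n :: int
    by (simp add: power2_eq_square field_simps)
  then have "theta2 q = (\<Sum>\<^sub>\<infinity>n::int. q powr (1 / 4) * q powr ((of_int n)\<^sup>2 + of_int n))"
    by (simp add: theta2_def powr_add)
  also have "\<dots> = q powr (1 / 4) * (\<Sum>\<^sub>\<infinity>n::int. q powr ((of_int n)\<^sup>2 + of_int n))"
    using q by (intro infsum_cmult_right')
  finally show ?thesis .
qed

text \<open>Once the lowest power \<open>q^(1/4)\<close> is taken out, the remaining exponent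
  \<open>n * (n + 1)\<close> vanishes exactly at 0 and -1; these two indices make up the limit
  2.\<close>

lemma theta2_tendsto: "((\<lambda>q. theta2 q / q powr (1 / 4)) \<longlongrightarrow> 2) (at_right 0)"
proof -
  have "((\<lambda>q::real. \<Sum>\<^sub>\<infinity>n::int. q powr ((of_int n)\<^sup>2 + of_int n)) \<longlongrightarrow> card {0::int, -1}) (at_right 0)"
  proof (rule infsum_powr_tendsto_card)
    fix n :: int assume "n \<notin> {0, -1}"
    then have "n \<ge> 1 \<or> n \<le> - 2"
      by auto
    then have "1 \<le> n * (n + 1)"
    proof
      assume "n \<le> - 2"
      then have "1 * 1 \<le> (- n) * (- (n + 1))"
        by (intro mult_mono) auto
      then show ?thesis
        unfolding minus_mult_minus by simp
    qed (use mult_mono[of 1 n 1 "n + 1"] in auto)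
    then have "1 \<le> real_of_int (n * (n + 1))"
      by linarith
    then show "1 \<le> (real_of_int n)\<^sup>2 + real_of_int n"
      by (simp add: power2_eq_square algebra_simps)
  next
    have *: "(of_int n)\<^sup>2 + of_int n = (of_int n + 1 / 2)\<^sup>2 + (- 1 / 4 :: real)" for n :: int
      by (simp add: power2_eq_square field_simps)
    show "(\<lambda>n::int. (1 / 2 :: real) powr ((of_int n)\<^sup>2 + of_int n)) summable_on UNIV"
      unfolding * powr_add by (intro summable_on_cmult_left theta_shift_summable) auto
  qed auto
  then have "((\<lambda>q::real. \<Sum>\<^sub>\<infinity>n::int. q powr ((of_int n)\<^sup>2 + of_int n)) \<longlongrightarrow> 2) (at_right 0)"
    by simp
  then show ?thesis
  proof (rule Lim_transform_eventually)
    show "\<forall>\<^sub>F q in at_right 0. (\<Sum>\<^sub>\<infinity>n::int. q powr ((of_int n)\<^sup>2 + of_int n)) = theta2 q / q powr (1 / 4)"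
      using eventually_at_right_real[OF zero_less_one]
      by eventually_elim (simp add: theta2_eq)
  qed
qed

lemma theta2_tendsto_0: "(theta2 \<longlongrightarrow> 0) (at_right 0)"
proof -
  have "((\<lambda>q::real. q powr (1 / 4)) \<longlongrightarrow> 0) (at_right 0)"
    by real_asymp
  from tendsto_mult[OF theta2_tendsto this] have "((\<lambda>q. theta2 q / q powr (1 / 4) * q powr (1 / 4)) \<longlongrightarrow> 0) (at_right 0)"
    by simp
  then show ?thesis
    by (rule Lim_transform_eventually)
      (use eventually_at_right_real[OF zero_less_one] in eventually_elim, simp)
qed

lemma power_two_power_tendsto:
  fixes q :: real
  assumes "0 < q" "q < 1"
  shows "filterlim (\<lambda>j. q ^ (2 ^ j)) (at_right 0) sequentially"
proof -
  have "filterlim (\<lambda>j::nat. 2 ^ j :: nat) sequentially sequentially"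
    by (rule filterlim_subseq) (simp add: strict_mono_def)
  moreover have "(\<lambda>n. q ^ n) \<longlonglongrightarrow> 0"
    using assms by (intro LIMSEQ_power_zero) auto
  ultimately have "(\<lambda>j. q ^ (2 ^ j)) \<longlonglongrightarrow> 0"
    by (rule filterlim_compose[rotated])
  then show ?thesis
    using assms by (auto simp: filterlim_at)
qed

text \<open>If the inequality failed at \<open>q\<close>, it would fail at \<open>q\<^sup>2\<close>, because
  \<open>theta3(q)\<^sup>2 - theta2(q)\<^sup>2 = (theta3(q\<^sup>2) - theta2(q\<^sup>2))\<^sup>2\<close>, and so on down to the limit at 0.\<close>

lemma theta2_less_theta3:
  assumes q: "0 < q" "q < 1"
  shows "theta2 q < theta3 q"
proof (rule ccontr)
  assume "\<not> theta2 q < theta3 q"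
  have qj: "0 < q ^ (2 ^ j)" "q ^ (2 ^ j) < 1" for j :: nat
    using q by (auto simp: power_less_one_iff)
  have le: "theta3 (q ^ (2 ^ j)) - theta2 (q ^ (2 ^ j)) \<le> 0" for j
  proof (induction j)
    case 0
    then show ?case
      using \<open>\<not> theta2 q < theta3 q\<close> by simp
  next
    case (Suc j)
    let ?r = "q ^ (2 ^ j)"
    have r2: "?r\<^sup>2 = q ^ (2 ^ Suc j)"
      by (simp flip: power_mult add: mult.commute)
    have "(theta3 ?r)\<^sup>2 \<le> (theta2 ?r)\<^sup>2"
      using Suc theta_pos[OF qj] by (intro power_mono) (auto simp: less_imp_le)
    then have "(theta3 (?r\<^sup>2) - theta2 (?r\<^sup>2))\<^sup>2 \<le> 0"
      using theta3_square[OF qj] theta2_square[OF qj] by (simp add: power2_diff mult_ac)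
    then show ?case
      unfolding r2 by simp
  qed
  have "((\<lambda>q. theta3 q - theta2 q) \<longlongrightarrow> 1 - 0) (at_right 0)"
    by (intro tendsto_diff theta3_tendsto theta2_tendsto_0)
  from filterlim_compose[OF this power_two_power_tendsto[OF q]]
  have "1 - 0 \<le> (0::real)"
    by (rule LIMSEQ_le_const2) (use le in auto)
  then show False
    by simp
qed

section \<open>The period ratio as a function of the nome\<close>

text \<open>This is \<open>K(k') / K(k)\<close> for the modulus \<open>k = theta2(q)\<^sup>2 / theta3(q)\<^sup>2\<close>, rescaled by
  homogeneity of the integrals.\<close>

definition period_ratio :: "real \<Rightarrow> real" where
  "period_ratio q = ellint ((theta3 q)\<^sup>2) ((theta2 q)\<^sup>2) /
    ellint ((theta3 q)\<^sup>2) (sqrt ((theta3 q) ^ 4 - (theta2 q) ^ 4))"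

lemma period_ratio_square:
  assumes q: "0 < q" "q < 1"
  shows "period_ratio (q\<^sup>2) = 2 * period_ratio q"
proof -
  have q2: "0 < q\<^sup>2" "q\<^sup>2 < 1"
    using q by (auto simp: power_less_one_iff abs_square_less_1)
  define a d where "a = (theta3 q)\<^sup>2" and "d = (theta2 q)\<^sup>2"
  define a1 d1 where "a1 = (theta3 (q\<^sup>2))\<^sup>2" and "d1 = (theta2 (q\<^sup>2))\<^sup>2"
  have pos: "a > 0" "d > 0" "a1 > 0" "d1 > 0"
    using theta_pos[OF q] theta_pos[OF q2] by (simp_all add: a_def d_def a1_def d1_def)
  have less: "d1 < a1"
    unfolding a1_def d1_def using theta2_less_theta3[OF q2] theta_pos[OF q2]
    by (intro power_strict_mono) auto
  have a: "a = 2 * ((a1 + d1) / 2)"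
    using theta3_square[OF q] by (simp add: a_def a1_def d1_def)
  have d: "d = 2 * sqrt (a1 * d1)"
    using theta2_square[OF q] theta_pos[OF q2]
    by (simp add: d_def a1_def d1_def real_sqrt_mult)
  \<comment> \<open>Hence \<open>a^2 - d^2\<close> is \<open>(a1 + d1)^2 - 4 * a1 * d1\<close>, a
    perfect square; \<open>less\<close> fixes the sign of its root.\<close>
  have "d\<^sup>2 = 4 * (a1 * d1)"
    using pos by (simp add: d)
  then have "a\<^sup>2 - d\<^sup>2 = (a1 - d1)\<^sup>2"
    by (simp add: a power2_eq_square algebra_simps)
  then have b: "sqrt (a\<^sup>2 - d\<^sup>2) = a1 - d1"
    using less by simp
  have "a1\<^sup>2 - d1\<^sup>2 = a * (a1 - d1)"
    by (simp add: a power2_eq_square algebra_simps)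
  then have b1: "sqrt (a1\<^sup>2 - d1\<^sup>2) = sqrt (a * (a1 - d1))"
    by simp
  have avg: "(a + (a1 - d1)) / 2 = a1"
    by (simp add: a field_simps)
  \<comment> \<open>Numerator: \<open>a\<close> and \<open>d\<close> are twice the arithmetic and
    geometric means of \<open>a1\<close> and \<open>d1\<close>, so homogeneity halves the integral.
    The denominator is unchanged, because \<open>a1\<close> and \<open>sqrt (a1^2 - d1^2)\<close>
    are the two means of \<open>a\<close> and \<open>a1 - d1\<close>.\<close>
  have "ellint a d = ellint a1 d1 / 2"
    unfolding a d using pos by (subst ellint_scale) (auto simp: ellint_agm)
  moreover have "ellint a1 (sqrt (a1\<^sup>2 - d1\<^sup>2)) = ellint a (sqrt (a\<^sup>2 - d\<^sup>2))"
    using ellint_agm[of a "a1 - d1"] pos less unfolding b b1 avg by simp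
  ultimately show ?thesis
    by (simp add: period_ratio_def a_def d_def a1_def d1_def flip: power_mult)
qed

text \<open>Monotonicity traps the value between the diagonal values at the maximum and the minimum
  of the arguments, and these are explicit.\<close>

lemma ellint_tendsto:
  assumes f: "(f \<longlongrightarrow> 1) F" and g: "(g \<longlongrightarrow> 1) F"
  shows "((\<lambda>x. ellint (f x) (g x)) \<longlongrightarrow> pi / 2) F"
proof (rule tendsto_sandwich)
  have ev: "\<forall>\<^sub>F x in F. 0 < f x \<and> 0 < g x"
    using order_tendstoD(1)[OF f, of 0] order_tendstoD(1)[OF g, of 0]
    by (auto intro: eventually_conj)
  show "\<forall>\<^sub>F x in F. pi / (2 * max (f x) (g x)) \<le> ellint (f x) (g x)"
    using ev
  proof eventually_elim
    case (elim x)
    have m: "0 < max (f x) (g x)"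
      using elim by (simp add: less_max_iff_disj)
    have "ellint (max (f x) (g x)) (max (f x) (g x)) \<le> ellint (f x) (g x)"
      using elim by (intro ellint_antimono) auto
    then show ?case
      unfolding ellint_diag[OF m] .
  qed
  show "\<forall>\<^sub>F x in F. ellint (f x) (g x) \<le> pi / (2 * min (f x) (g x))"
    using ev
  proof eventually_elim
    case (elim x)
    have m: "0 < min (f x) (g x)"
      using elim by simp
    have "ellint (f x) (g x) \<le> ellint (min (f x) (g x)) (min (f x) (g x))"
      using elim by (intro ellint_antimono) auto
    then show ?case
      unfolding ellint_diag[OF m] .
  qed
  have "((\<lambda>x. pi / (2 * max (f x) (g x))) \<longlongrightarrow> pi / (2 * max 1 1)) F"
    by (intro tendsto_intros f g) auto
  then show "((\<lambda>x. pi / (2 * max (f x) (g x))) \<longlongrightarrow> pi / 2) F"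
    by simp
  have "((\<lambda>x. pi / (2 * min (f x) (g x))) \<longlongrightarrow> pi / (2 * min 1 1)) F"
    by (intro tendsto_intros f g) auto
  then show "((\<lambda>x. pi / (2 * min (f x) (g x))) \<longlongrightarrow> pi / 2) F"
    by simp
qed

lemma theta_modulus_tendsto:
  "filterlim (\<lambda>q. (theta2 q)\<^sup>2 / (theta3 q)\<^sup>2) (at_right 0) (at_right 0)"
proof -
  have "((\<lambda>q. (theta2 q)\<^sup>2 / (theta3 q)\<^sup>2) \<longlongrightarrow> 0\<^sup>2 / 1\<^sup>2) (at_right 0)"
    by (intro tendsto_intros theta2_tendsto_0 theta3_tendsto) auto
  moreover have "\<forall>\<^sub>F q in at_right 0. (theta2 q)\<^sup>2 / (theta3 q)\<^sup>2 > 0"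
    using eventually_at_right_real[OF zero_less_one]
    by eventually_elim (use theta_pos in force)
  ultimately show ?thesis
    by (auto simp: filterlim_at elim: eventually_mono)
qed

lemma ln_theta_modulus_tendsto:
  "((\<lambda>q. ln ((theta2 q)\<^sup>2 / (theta3 q)\<^sup>2) / ln q) \<longlongrightarrow> 1 / 2) (at_right 0)"
proof -
  \<comment> \<open>This is the modulus divided by \<open>q^(1/2)\<close>. It tends to 4, so its
    logarithm is negligible against \<open>ln q\<close> and only the exponent 1/2 remains.\<close>
  define w where "w q = (theta2 q / q powr (1 / 4))\<^sup>2 / (theta3 q)\<^sup>2" for q
  have "(w \<longlongrightarrow> 2\<^sup>2 / 1\<^sup>2) (at_right 0)"
    unfolding w_def by (intro tendsto_intros theta2_tendsto theta3_tendsto) auto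
  then have "((\<lambda>q. ln (w q)) \<longlongrightarrow> ln 4) (at_right 0)"
    by (intro tendsto_ln) auto
  moreover have "((\<lambda>q::real. inverse (ln q)) \<longlongrightarrow> 0) (at_right 0)"
    by real_asymp
  ultimately have "((\<lambda>q. ln (w q) * inverse (ln q) + 1 / 2) \<longlongrightarrow> ln 4 * 0 + 1 / 2) (at_right 0)"
    by (intro tendsto_add tendsto_mult tendsto_const)
  then have "((\<lambda>q. ln (w q) * inverse (ln q) + 1 / 2) \<longlongrightarrow> 1 / 2) (at_right 0)"
    by simp
  then show ?thesis
  proof (rule Lim_transform_eventually)
    show "\<forall>\<^sub>F q in at_right 0. ln (w q) * inverse (ln q) + 1 / 2 = ln ((theta2 q)\<^sup>2 / (theta3 q)\<^sup>2) / ln q"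
      using eventually_at_right_real[OF zero_less_one]
    proof eventually_elim
      case (elim q)
      then have q: "0 < q" "q < 1"
        by auto
      have w: "w q > 0"
        unfolding w_def using theta_pos[OF q] q by simp
      have "(q powr (1 / 4))\<^sup>2 = q powr (1 / 2)"
        using q by (simp add: powr_power)
      then have "(theta2 q)\<^sup>2 / (theta3 q)\<^sup>2 = w q * q powr (1 / 2)"
        unfolding w_def using q by (simp add: power_divide)
      then have "ln ((theta2 q)\<^sup>2 / (theta3 q)\<^sup>2) = ln (w q) + 1 / 2 * ln q"
        using w q by (simp add: ln_mult ln_powr)
      moreover have "ln q \<noteq> 0"
        using q by simp
      ultimately show ?case
        by (simp add: field_simps)
    qed
  qed
qed

lemma ellint_homogeneous:
  assumes "a > 0" "b > 0"
  shows "ellint a b = ellint 1 (b / a) / a"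
  using ellint_scale[of a 1 "b / a"] assms by simp

text \<open>After scaling, the numerator behaves like \<open>- ln \<kappa>\<close>, that is like
  \<open>- (ln q) / 2\<close>, and the denominator tends to pi/2.\<close>

lemma period_ratio_tendsto: "((\<lambda>q. period_ratio q / (- ln q)) \<longlongrightarrow> 1 / pi) (at_right 0)"
proof -
  define \<kappa> where "\<kappa> q = (theta2 q)\<^sup>2 / (theta3 q)\<^sup>2" for q
  define J where "J q = ellint ((theta3 q)\<^sup>2) (sqrt ((theta3 q) ^ 4 - (theta2 q) ^ 4))" for q
  have "((\<lambda>q. (theta3 q)\<^sup>2) \<longlongrightarrow> 1\<^sup>2) (at_right 0)"
    by (intro tendsto_intros theta3_tendsto)
  moreover have "((\<lambda>q. sqrt ((theta3 q) ^ 4 - (theta2 q) ^ 4)) \<longlongrightarrow> sqrt (1 ^ 4 - 0 ^ 4)) (at_right 0)"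
    by (intro tendsto_intros theta3_tendsto theta2_tendsto_0)
  ultimately have J: "(J \<longlongrightarrow> pi / 2) (at_right 0)"
    unfolding J_def by (intro ellint_tendsto) auto
  have "((\<lambda>q. ellint 1 (\<kappa> q) / (- ln (\<kappa> q))) \<longlongrightarrow> 1) (at_right 0)"
    unfolding \<kappa>_def by (rule filterlim_compose[OF ellint_asymptotic theta_modulus_tendsto])
  moreover have "((\<lambda>q. ln (\<kappa> q) / ln q) \<longlongrightarrow> 1 / 2) (at_right 0)"
    unfolding \<kappa>_def by (rule ln_theta_modulus_tendsto)
  ultimately have "((\<lambda>q. ellint 1 (\<kappa> q) / (- ln (\<kappa> q)) * (ln (\<kappa> q) / ln q) / (theta3 q)\<^sup>2 / J q) \<longlongrightarrow>
      1 * (1 / 2) / 1\<^sup>2 / (pi / 2)) (at_right 0)"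
    by (intro tendsto_divide[OF tendsto_divide[OF tendsto_mult]] tendsto_power theta3_tendsto J) auto
  then have "((\<lambda>q. ellint 1 (\<kappa> q) / (- ln (\<kappa> q)) * (ln (\<kappa> q) / ln q) / (theta3 q)\<^sup>2 / J q) \<longlongrightarrow>
      1 / pi) (at_right 0)"
    by simp
  then show ?thesis
  proof (rule Lim_transform_eventually)
    show "\<forall>\<^sub>F q in at_right 0. ellint 1 (\<kappa> q) / (- ln (\<kappa> q)) * (ln (\<kappa> q) / ln q) / (theta3 q)\<^sup>2 / J q =
        period_ratio q / (- ln q)"
      using eventually_at_right_real[OF zero_less_one]
    proof eventually_elim
      case (elim q)
      then have q: "0 < q" "q < 1"
        by auto
      have "\<kappa> q < 1" "\<kappa> q > 0"
        unfolding \<kappa>_def using theta_pos[OF q] theta2_less_theta3[OF q]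
        by (auto intro: power_strict_mono)
      then have "ln (\<kappa> q) \<noteq> 0"
        by simp
      moreover have "period_ratio q = ellint 1 (\<kappa> q) / (theta3 q)\<^sup>2 / J q"
        unfolding period_ratio_def J_def \<kappa>_def
        using theta_pos[OF q] by (subst ellint_homogeneous) auto
      ultimately show ?case
        by simp
    qed
  qed
qed

text \<open>Squaring the nome doubles both \<open>period_ratio\<close> and \<open>ln\<close>, so
  their quotient is constant along \<open>q ^ (2 ^ j)\<close>; a constant sequence equals its
  limit.\<close>

lemma period_ratio_eq:
  assumes q: "0 < q" "q < 1"
  shows "period_ratio q = - ln q / pi"
proof -
  have qj: "0 < q ^ (2 ^ j)" "q ^ (2 ^ j) < 1" for j :: nat
    using q by (auto simp: power_less_one_iff)
  have iter: "period_ratio (q ^ (2 ^ j)) = 2 ^ j * period_ratio q" for j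
  proof (induction j)
    case (Suc j)
    have "q ^ (2 ^ Suc j) = (q ^ (2 ^ j))\<^sup>2"
      by (simp flip: power_mult add: mult.commute)
    then show ?case
      using Suc period_ratio_square[OF qj[of j]] by simp
  qed simp
  have "(\<lambda>j. period_ratio (q ^ (2 ^ j)) / (- ln (q ^ (2 ^ j)))) \<longlonglongrightarrow> 1 / pi"
    by (rule filterlim_compose[OF period_ratio_tendsto power_two_power_tendsto[OF q]])
  moreover have "period_ratio (q ^ (2 ^ j)) / (- ln (q ^ (2 ^ j))) = period_ratio q / (- ln q)" for j
    using q by (simp add: iter ln_realpow)
  ultimately have "period_ratio q / (- ln q) = 1 / pi"
    by (simp add: LIMSEQ_const_iff)
  moreover have "ln q \<noteq> 0"
    using q by simp
  ultimately show ?thesis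
    by (simp add: field_simps)
qed

lemma
  assumes q: "0 < q" "q < 1"
  shows theta_modulus_in: "(theta2 q)\<^sup>2 / (theta3 q)\<^sup>2 \<in> {0<..<1}"
    and theta_modulus_period: "elliptic_K (sqrt (1 - ((theta2 q)\<^sup>2 / (theta3 q)\<^sup>2)\<^sup>2)) /
      elliptic_K ((theta2 q)\<^sup>2 / (theta3 q)\<^sup>2) = - ln q / pi"
proof -
  define a d \<kappa> where "a = (theta3 q)\<^sup>2" and "d = (theta2 q)\<^sup>2" and "\<kappa> = d / a"
  have pos: "a > 0" "d > 0"
    using theta_pos[OF q] by (simp_all add: a_def d_def)
  have less: "d < a"
    unfolding a_def d_def using theta2_less_theta3[OF q] theta_pos[OF q]
    by (intro power_strict_mono) auto
  have kappa: "\<kappa> \<in> {0<..<1}"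
    using pos less by (simp add: \<kappa>_def)
  then show "(theta2 q)\<^sup>2 / (theta3 q)\<^sup>2 \<in> {0<..<1}"
    by (simp add: \<kappa>_def a_def d_def)
  have k2: "\<kappa>\<^sup>2 < 1" "\<kappa>\<^sup>2 > 0"
    using kappa by (auto simp: power_less_one_iff abs_square_less_1)
  have d2: "d\<^sup>2 < a\<^sup>2"
    using less pos by (intro power_strict_mono) auto
  have "1 - \<kappa>\<^sup>2 = (a\<^sup>2 - d\<^sup>2) / a\<^sup>2"
    using pos by (simp add: \<kappa>_def field_simps)
  then have k': "sqrt (1 - \<kappa>\<^sup>2) = sqrt (a\<^sup>2 - d\<^sup>2) / a"
    using pos by (simp add: real_sqrt_divide)
  have "elliptic_K \<kappa> = a * ellint a (sqrt (a\<^sup>2 - d\<^sup>2))"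
    using elliptic_K_eq_ellint[OF kappa] pos d2 unfolding k'
    by (subst ellint_homogeneous) auto
  \<comment> \<open>The modulus complementary to \<open>sqrt (1 - \<kappa>^2)\<close> is
    \<open>\<kappa> = d / a\<close> itself.\<close>
  moreover have "elliptic_K (sqrt (1 - \<kappa>\<^sup>2)) = a * ellint a d"
    using elliptic_K_eq_ellint[of "sqrt (1 - \<kappa>\<^sup>2)"] k2 pos kappa
    by (subst ellint_homogeneous) (auto simp: \<kappa>_def)
  ultimately have "elliptic_K (sqrt (1 - \<kappa>\<^sup>2)) / elliptic_K \<kappa> = period_ratio q"
    using pos by (simp add: period_ratio_def a_def d_def flip: power_mult)
  then show "elliptic_K (sqrt (1 - ((theta2 q)\<^sup>2 / (theta3 q)\<^sup>2)\<^sup>2)) /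
      elliptic_K ((theta2 q)\<^sup>2 / (theta3 q)\<^sup>2) = - ln q / pi"
    using period_ratio_eq[OF q] by (simp add: \<kappa>_def a_def d_def)
qed

section \<open>Uniqueness of the modulus with a given nome\<close>

lemma elliptic_K_strict_mono:
  assumes "0 < k" "k < l" "l < 1"
  shows "0 < elliptic_K k" "elliptic_K k < elliptic_K l"
proof -
  have "k\<^sup>2 < l\<^sup>2" "k\<^sup>2 < 1" "l\<^sup>2 < 1"
    using assms by (auto simp: power_less_one_iff abs_square_less_1 intro: power_strict_mono)
  then show "elliptic_K k < elliptic_K l" "0 < elliptic_K k"
    using assms by (auto simp: elliptic_K_eq_ellint intro!: ellint_strict_antimono ellint_pos)
qed

text \<open>As the modulus grows its complement shrinks, so the numerator decreases while the
  denominator increases.\<close>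

lemma elliptic_K_ratio_inj:
  "inj_on (\<lambda>k. elliptic_K (sqrt (1 - k\<^sup>2)) / elliptic_K k) {0<..<1}"
proof (rule linorder_inj_onI)
  fix k l :: real assume kl: "k < l" "k \<in> {0<..<1}" "l \<in> {0<..<1}"
  have "k\<^sup>2 < l\<^sup>2" "l\<^sup>2 < 1" "0 < k\<^sup>2"
    using kl by (auto simp: power_less_one_iff abs_square_less_1 intro: power_strict_mono)
  then have "0 < elliptic_K (sqrt (1 - l\<^sup>2))" "elliptic_K (sqrt (1 - l\<^sup>2)) < elliptic_K (sqrt (1 - k\<^sup>2))"
    using elliptic_K_strict_mono[of "sqrt (1 - l\<^sup>2)" "sqrt (1 - k\<^sup>2)"] by auto
  moreover have "0 < elliptic_K k" "elliptic_K k < elliptic_K l"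
    using kl elliptic_K_strict_mono[of k l] by auto
  ultimately have "elliptic_K (sqrt (1 - l\<^sup>2)) / elliptic_K l < elliptic_K (sqrt (1 - k\<^sup>2)) / elliptic_K k"
    by (intro frac_less) auto
  then show "elliptic_K (sqrt (1 - k\<^sup>2)) / elliptic_K k \<noteq> elliptic_K (sqrt (1 - l\<^sup>2)) / elliptic_K l"
    by simp
qed auto

lemma elliptic_modulus_eq:
  assumes q: "0 < q" "q < 1"
  shows "elliptic_modulus q = (theta2 q)\<^sup>2 / (theta3 q)\<^sup>2"
proof -
  have nome: "elliptic_nome k = q \<longleftrightarrow> elliptic_K (sqrt (1 - k\<^sup>2)) / elliptic_K k = - ln q / pi" for k
  proof -
    have "elliptic_nome k = q \<longleftrightarrow> - pi * elliptic_K (sqrt (1 - k\<^sup>2)) / elliptic_K k = ln q"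
      unfolding elliptic_nome_def using q by (metis exp_ln ln_exp)
    also have "\<dots> \<longleftrightarrow> elliptic_K (sqrt (1 - k\<^sup>2)) / elliptic_K k = - ln q / pi"
      by (auto simp: field_simps)
    finally show ?thesis .
  qed
  show ?thesis
    unfolding elliptic_modulus_def nome
  proof (rule the_equality)
    fix k assume "k \<in> {0<..<1} \<and> elliptic_K (sqrt (1 - k\<^sup>2)) / elliptic_K k = - ln q / pi"
    then show "k = (theta2 q)\<^sup>2 / (theta3 q)\<^sup>2"
      by (intro inj_onD[OF elliptic_K_ratio_inj _ _ theta_modulus_in[OF q]])
        (simp_all only: theta_modulus_period[OF q])
  qed (use theta_modulus_in[OF q] theta_modulus_period[OF q] in blast)
qed

section \<open>The discrete Gaussian mixture\<close>

lemma distr_eq_if_point_probabilities_eq: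
  fixes X :: "'a \<Rightarrow> 'c::countable" and Y :: "'b \<Rightarrow> 'c"
  assumes "prob_space M" "prob_space N"
    and X: "X \<in> measurable M (count_space UNIV)" and Y: "Y \<in> measurable N (count_space UNIV)"
    and eq: "\<And>x. measure M {\<omega> \<in> space M. X \<omega> = x} = measure N {\<omega> \<in> space N. Y \<omega> = x}"
  shows "distr M (count_space UNIV) X = distr N (count_space UNIV) Y"
proof -
  interpret M: prob_space M by fact
  interpret N: prob_space N by fact
  show ?thesis
  proof (rule measure_eqI_countable[where A = UNIV])
    fix x
    have "X -` {x} \<inter> space M = {\<omega> \<in> space M. X \<omega> = x}" "Y -` {x} \<inter> space N = {\<omega> \<in> space N. Y \<omega> = x}"
      by auto
    then show "emeasure (distr M (count_space UNIV) X) {x} = emeasure (distr N (count_space UNIV) Y) {x}"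
      using X Y eq by (simp add: emeasure_distr M.emeasure_eq_measure N.emeasure_eq_measure)
  qed auto
qed

lemma (in prob_space) indep_vars_prob_three:
  assumes "indep_vars (\<lambda>_. count_space UNIV) X I" and "i \<in> I" "j \<in> I" "k \<in> I"
    and "i \<noteq> j" "i \<noteq> k" "j \<noteq> k"
  shows "prob {\<omega> \<in> space M. X i \<omega> = x \<and> X j \<omega> = y \<and> X k \<omega> = z} =
    prob {\<omega> \<in> space M. X i \<omega> = x} * prob {\<omega> \<in> space M. X j \<omega> = y} * prob {\<omega> \<in> space M. X k \<omega> = z}"
proof -
  define A where "A l = (if l = i then {x} else if l = j then {y} else {z})" for l
  have A: "A i = {x}" "A j = {y}" "A k = {z}"
    using assms by (auto simp: A_def)
  have "prob (\<Inter>l\<in>{i, j, k}. X l -` A l \<inter> space M) = (\<Prod>l\<in>{i, j, k}. prob (X l -` A l \<inter> space M))"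
    by (rule indep_varsD[OF assms(1)]) (use assms in auto)
  moreover have "(\<Inter>l\<in>{i, j, k}. X l -` A l \<inter> space M) = {\<omega> \<in> space M. X i \<omega> = x \<and> X j \<omega> = y \<and> X k \<omega> = z}"
    by (auto simp: A)
  moreover have "X l -` {w} \<inter> space M = {\<omega> \<in> space M. X l \<omega> = w}" for l w
    by auto
  ultimately show ?thesis
    using assms by (simp add: A mult.assoc)
qed

lemma (in prob_space) indep_var_prob_two:
  assumes "indep_var (count_space UNIV) X (count_space UNIV) Y"
  shows "prob {\<omega> \<in> space M. (X \<omega>, Y \<omega>) = (x, y)} =
    prob {\<omega> \<in> space M. X \<omega> = x} * prob {\<omega> \<in> space M. Y \<omega> = y}"
proof -
  have "(\<lambda>\<omega>. (X \<omega>, Y \<omega>)) -` ({x} \<times> {y}) \<inter> space M = {\<omega> \<in> space M. (X \<omega>, Y \<omega>) = (x, y)}"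
    "X -` {x} \<inter> space M = {\<omega> \<in> space M. X \<omega> = x}" "Y -` {y} \<inter> space M = {\<omega> \<in> space M. Y \<omega> = y}"
    by auto
  then show ?thesis
    using indep_varD[OF assms, of "{x}" "{y}"] by simp
qed

text \<open>The two prescribed point masses already add up to 1. This confines to a null set the
  other integer values of \<open>B\<close>, at which the mixture would not select one of its two
  components.\<close>

lemma bernoulli_distributed_AE:
  assumes "prob_space M" "bernoulli_distributed p M B"
  shows "AE \<omega> in M. B \<omega> = 1 \<or> B \<omega> = 0"
proof -
  interpret prob_space M by fact
  have B[measurable]: "B \<in> measurable M (count_space UNIV)"
    using assms(2) by (simp add: bernoulli_distributed_def)
  have "prob ({\<omega> \<in> space M. B \<omega> = 1} \<union> {\<omega> \<in> space M. B \<omega> = 0}) =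
      prob {\<omega> \<in> space M. B \<omega> = 1} + prob {\<omega> \<in> space M. B \<omega> = 0}"
    by (rule finite_measure_Union) auto
  also have "\<dots> = 1"
    using assms(2) by (simp add: bernoulli_distributed_def)
  also have "{\<omega> \<in> space M. B \<omega> = 1} \<union> {\<omega> \<in> space M. B \<omega> = 0} = {\<omega> \<in> space M. B \<omega> = 1 \<or> B \<omega> = 0}"
    by auto
  finally show ?thesis
    by (subst (asm) prob_Collect_eq_1) auto
qed

text \<open>The coordinates of \<open>W\<close> have an even sum if \<open>B = 1\<close> and an odd
  one if \<open>B = 0\<close>. A lattice point therefore determines \<open>B\<close> and the two
  Gaussian values in use, and its probability is a product of three factors. The weight
  \<open>p\<close> or \<open>1 - p\<close> cancels the normalisation at nome \<open>q^2\<close> and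
  leaves the one at nome \<open>q\<close> in both cases.\<close>

lemma discrete_gauss_mixture_point_probabilities:
  fixes c p :: real and Y3 Y3' Y2 Y2' B :: "'b \<Rightarrow> int"
  assumes c: "c > 0" and N: "prob_space N"
    and Y3: "theta3_distributed (2 * c) N Y3" and Y3': "theta3_distributed (2 * c) N Y3'"
    and Y2: "theta2_distributed (2 * c) N Y2" and Y2': "theta2_distributed (2 * c) N Y2'"
    and q_eq: "q = exp (- pi * c)"
    and p3: "p = (theta3 (q\<^sup>2))\<^sup>2 / (theta3 q)\<^sup>2" and p2: "1 - p = (theta2 (q\<^sup>2))\<^sup>2 / (theta3 q)\<^sup>2"
    and B: "bernoulli_distributed p N B"
    and indep: "prob_space.indep_vars N (\<lambda>_. count_space UNIV) (\<lambda>i. [Y3, Y3', Y2, Y2', B] ! i) {..<5}"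
  defines "W \<equiv> (\<lambda>\<omega>. (B \<omega> * (Y3 \<omega> + Y3' \<omega>) + (1 - B \<omega>) * (Y2 \<omega> + Y2' \<omega> + 1),
      B \<omega> * (Y3 \<omega> - Y3' \<omega>) + (1 - B \<omega>) * (Y2 \<omega> - Y2' \<omega>)))"
  shows "measure N {\<omega> \<in> space N. W \<omega> = (m, n)} =
    exp (- c * pi * (of_int m)\<^sup>2) / theta3 q * (exp (- c * pi * (of_int n)\<^sup>2) / theta3 q)"
proof -
  interpret prob_space N by fact
  have q: "0 < q" "q < 1"
    using c by (simp_all add: q_eq)
  have q2: "0 < q\<^sup>2" "q\<^sup>2 < 1"
    using q by (auto simp: power_less_one_iff abs_square_less_1)
  have q2_eq: "exp (- (2 * c) * pi) = q\<^sup>2"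
    by (simp add: q_eq flip: exp_double)
  note theta = theta_pos[OF q] theta_pos[OF q2]
  have [measurable]: "Y3 \<in> measurable N (count_space UNIV)" "Y3' \<in> measurable N (count_space UNIV)"
    "Y2 \<in> measurable N (count_space UNIV)" "Y2' \<in> measurable N (count_space UNIV)"
    "B \<in> measurable N (count_space UNIV)"
    using Y3 Y3' Y2 Y2' B
    by (simp_all add: theta3_distributed_def theta2_distributed_def bernoulli_distributed_def)
  have pY3: "prob {\<omega> \<in> space N. Y3 \<omega> = n} = exp (- (2 * c) * pi * (of_int n)\<^sup>2) / theta3 (q\<^sup>2)"
    "prob {\<omega> \<in> space N. Y3' \<omega> = n} = exp (- (2 * c) * pi * (of_int n)\<^sup>2) / theta3 (q\<^sup>2)" for n
    using Y3 Y3' unfolding theta3_distributed_def q2_eq by blast+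
  have pY2: "prob {\<omega> \<in> space N. Y2 \<omega> = n} = exp (- (2 * c) * pi * (of_int n + 1 / 2)\<^sup>2) / theta2 (q\<^sup>2)"
    "prob {\<omega> \<in> space N. Y2' \<omega> = n} = exp (- (2 * c) * pi * (of_int n + 1 / 2)\<^sup>2) / theta2 (q\<^sup>2)" for n
    using Y2 Y2' unfolding theta2_distributed_def q2_eq by blast+
  have pB: "prob {\<omega> \<in> space N. B \<omega> = 1} = p" "prob {\<omega> \<in> space N. B \<omega> = 0} = 1 - p"
    using B by (simp_all add: bernoulli_distributed_def)
  have [measurable]: "{\<omega> \<in> space N. W \<omega> = (m, n)} \<in> events"
    unfolding W_def by measurable
  show ?thesis
  proof (cases "even (m + n)")
    case True
    then have "(m, n) \<in> range (\<lambda>(u, v). (u + v, u - v))"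
      unfolding range_parity_even by simp
    then obtain u v where mn: "m = u + v" "n = u - v"
      by auto
    have iff: "W \<omega> = (m, n) \<longleftrightarrow> Y3 \<omega> = u \<and> Y3' \<omega> = v \<and> B \<omega> = 1" if "B \<omega> = 1 \<or> B \<omega> = 0" for \<omega>
      using that
    proof
      assume "B \<omega> = 0"
      \<comment> \<open>Adding the two equations would equate an odd number with
        \<open>2 * u\<close>.\<close>
      moreover have "\<not> (Y2 \<omega> + Y2' \<omega> + 1 = u + v \<and> Y2 \<omega> - Y2' \<omega> = u - v)"
        by presburger
      ultimately show ?thesis
        by (auto simp: W_def mn)
    qed (auto simp: W_def mn)
    have "prob {\<omega> \<in> space N. W \<omega> = (m, n)} = prob {\<omega> \<in> space N. Y3 \<omega> = u \<and> Y3' \<omega> = v \<and> B \<omega> = 1}"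
    proof (rule finite_measure_eq_AE)
      show "AE \<omega> in N. \<omega> \<in> {\<omega> \<in> space N. W \<omega> = (m, n)} \<longleftrightarrow>
          \<omega> \<in> {\<omega> \<in> space N. Y3 \<omega> = u \<and> Y3' \<omega> = v \<and> B \<omega> = 1}"
        using bernoulli_distributed_AE[OF N B] by eventually_elim (auto simp: iff)
    qed measurable
    also have "\<dots> = prob {\<omega> \<in> space N. Y3 \<omega> = u} * prob {\<omega> \<in> space N. Y3' \<omega> = v} * prob {\<omega> \<in> space N. B \<omega> = 1}"
      using indep_vars_prob_three[OF indep, of 0 1 4 u v 1] by simp
    also have "\<dots> = exp (- (2 * c) * pi * (of_int u)\<^sup>2) * exp (- (2 * c) * pi * (of_int v)\<^sup>2) / (theta3 q)\<^sup>2"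
      unfolding pY3 pB p3 using theta by (simp add: power2_eq_square)
    also have "exp (- (2 * c) * pi * (of_int u)\<^sup>2) * exp (- (2 * c) * pi * (of_int v)\<^sup>2) =
        exp (- c * pi * (of_int m)\<^sup>2) * exp (- c * pi * (of_int n)\<^sup>2)"
      unfolding exp_add[symmetric] mn by (simp add: power2_eq_square algebra_simps)
    finally show ?thesis
      by (simp add: power2_eq_square)
  next
    case False
    then have "(m, n) \<in> range (\<lambda>(u, v). (u + v + 1, u - v))"
      unfolding range_parity_odd by simp
    then obtain u v where mn: "m = u + v + 1" "n = u - v"
      by auto
    have iff: "W \<omega> = (m, n) \<longleftrightarrow> Y2 \<omega> = u \<and> Y2' \<omega> = v \<and> B \<omega> = 0" if "B \<omega> = 1 \<or> B \<omega> = 0" for \<omega>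
      using that
    proof
      assume "B \<omega> = 1"
      moreover have "\<not> (Y3 \<omega> + Y3' \<omega> = u + v + 1 \<and> Y3 \<omega> - Y3' \<omega> = u - v)"
        by presburger
      ultimately show ?thesis
        by (auto simp: W_def mn)
    qed (auto simp: W_def mn)
    have "prob {\<omega> \<in> space N. W \<omega> = (m, n)} = prob {\<omega> \<in> space N. Y2 \<omega> = u \<and> Y2' \<omega> = v \<and> B \<omega> = 0}"
    proof (rule finite_measure_eq_AE)
      show "AE \<omega> in N. \<omega> \<in> {\<omega> \<in> space N. W \<omega> = (m, n)} \<longleftrightarrow>
          \<omega> \<in> {\<omega> \<in> space N. Y2 \<omega> = u \<and> Y2' \<omega> = v \<and> B \<omega> = 0}"
        using bernoulli_distributed_AE[OF N B] by eventually_elim (auto simp: iff)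
    qed measurable
    also have "\<dots> = prob {\<omega> \<in> space N. Y2 \<omega> = u} * prob {\<omega> \<in> space N. Y2' \<omega> = v} * prob {\<omega> \<in> space N. B \<omega> = 0}"
      using indep_vars_prob_three[OF indep, of 2 3 4 u v 0] by simp
    also have "\<dots> = exp (- (2 * c) * pi * (of_int u + 1 / 2)\<^sup>2) * exp (- (2 * c) * pi * (of_int v + 1 / 2)\<^sup>2) / (theta3 q)\<^sup>2"
      unfolding pY2 pB p2 using theta by (simp add: power2_eq_square)
    also have "exp (- (2 * c) * pi * (of_int u + 1 / 2)\<^sup>2) * exp (- (2 * c) * pi * (of_int v + 1 / 2)\<^sup>2) =
        exp (- c * pi * (of_int m)\<^sup>2) * exp (- c * pi * (of_int n)\<^sup>2)"
      unfolding exp_add[symmetric] mn by (simp add: power2_eq_square field_simps)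
    finally show ?thesis
      by (simp add: power2_eq_square)
  qed
qed

theorem theorem7p21:
  fixes c q k a b p :: real
    and M :: "'a measure" and X X' :: "'a \<Rightarrow> int"
    and N :: "'b measure" and Y3 Y3' Y2 Y2' B :: "'b \<Rightarrow> int"
    and Z3 Z2 :: "'b \<Rightarrow> real"
  assumes c_pos: "c > 0"
    and q_eq: "q = exp (- pi * c)"
    and k: "k \<in> {0<..<1}"
    and c_eq: "c = elliptic_K (sqrt (1 - k\<^sup>2)) / elliptic_K k"
    and M: "prob_space M"
    and X: "theta3_distributed c M X"
    and X': "theta3_distributed c M X'"
    and indep_X: "prob_space.indep_var M (count_space UNIV) X (count_space UNIV) X'"
    and N: "prob_space N"
    and Y3: "theta3_distributed (2 * c) N Y3"
    and Y3': "theta3_distributed (2 * c) N Y3'"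
    and Y2: "theta2_distributed (2 * c) N Y2"
    and Y2': "theta2_distributed (2 * c) N Y2'"
    and p_eq: "p = (theta3 (q\<^sup>2))\<^sup>2 / (theta3 q)\<^sup>2"
    and B: "bernoulli_distributed p N B"
    and indep_Y: "prob_space.indep_vars N (\<lambda>_. count_space UNIV)
                    (\<lambda>i. [Y3, Y3', Y2, Y2', B] ! i) {..<5}"
    and Z3_eq: "\<And>\<omega>. Z3 \<omega> = a * of_int (Y3 \<omega> + Y3' \<omega>) + b * of_int (Y3 \<omega> - Y3' \<omega>)"
    and Z2_eq: "\<And>\<omega>. Z2 \<omega> = a * of_int (Y2 \<omega> + Y2' \<omega> + 1) + b * of_int (Y2 \<omega> - Y2' \<omega>)"
  shows "distr M borel (\<lambda>\<omega>. a * of_int (X \<omega>) + b * of_int (X' \<omega>)) =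
           distr N borel (\<lambda>\<omega>. of_int (B \<omega>) * Z3 \<omega> + (1 - of_int (B \<omega>)) * Z2 \<omega>)
       \<and> p = (theta3 (exp (- 2 * pi * c)))\<^sup>2 / (theta3 (exp (- pi * c)))\<^sup>2
       \<and> p = (1 + sqrt (1 - k\<^sup>2)) / 2
       \<and> p = 1 / (1 + elliptic_modulus (q\<^sup>2))
       \<and> 1 - p = (theta2 (q\<^sup>2))\<^sup>2 / (theta3 q)\<^sup>2
       \<and> 1 - p = (1 - sqrt (1 - k\<^sup>2)) / 2
       \<and> 1 - p = elliptic_modulus (q\<^sup>2) / (1 + elliptic_modulus (q\<^sup>2))"
proof -
  have q: "0 < q" "q < 1"
    using c_pos by (simp_all add: q_eq)
  have q2: "0 < q\<^sup>2" "q\<^sup>2 < 1"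
    using q by (auto simp: power_less_one_iff abs_square_less_1)
  define s t where "s = (theta3 (q\<^sup>2))\<^sup>2" and "t = (theta2 (q\<^sup>2))\<^sup>2"
  have pos: "s > 0" "t > 0"
    using theta_pos[OF q2] by (simp_all add: s_def t_def)
  have less: "t < s"
    unfolding s_def t_def using theta2_less_theta3[OF q2] theta_pos[OF q2]
    by (intro power_strict_mono) auto
  have st: "(theta3 q)\<^sup>2 = s + t"
    using theta3_square[OF q] by (simp add: s_def t_def)
  have p: "p = s / (s + t)"
    unfolding p_eq st by (simp add: s_def)
  have one_p: "1 - p = t / (s + t)"
    using pos by (simp add: p field_simps)
  have p2: "1 - p = (theta2 (q\<^sup>2))\<^sup>2 / (theta3 q)\<^sup>2"
    unfolding one_p st by (simp add: t_def)
  \<comment> \<open>The modulus at \<open>q^2\<close> is \<open>t / s\<close>, while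
    \<open>1 - p\<close> is \<open>t / (s + t)\<close>; this is why \<open>1 - p\<close> comes out
    as k(q^2) / (1 + k(q^2)).\<close>
  have modulus2: "elliptic_modulus (q\<^sup>2) = t / s"
    using elliptic_modulus_eq[OF q2] by (simp add: s_def t_def)
  \<comment> \<open>The given \<open>k\<close> and the theta quotient have the same period ratio
    \<open>c\<close>, and the ratio is injective.\<close>
  have k_eq: "k = (theta2 q)\<^sup>2 / (theta3 q)\<^sup>2"
  proof (rule inj_onD[OF elliptic_K_ratio_inj _ k theta_modulus_in[OF q]])
    show "elliptic_K (sqrt (1 - k\<^sup>2)) / elliptic_K k =
      elliptic_K (sqrt (1 - ((theta2 q)\<^sup>2 / (theta3 q)\<^sup>2)\<^sup>2)) / elliptic_K ((theta2 q)\<^sup>2 / (theta3 q)\<^sup>2)"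
      unfolding theta_modulus_period[OF q] c_eq[symmetric] by (simp add: q_eq)
  qed
  have d: "((theta2 q)\<^sup>2)\<^sup>2 = 4 * (s * t)"
    unfolding theta2_square[OF q] by (simp add: s_def t_def power_mult_distrib)
  \<comment> \<open>The duplication formula makes \<open>k^2\<close> equal to
    \<open>4 * s * t / (s + t)^2\<close>, so the complement is a perfect square, with positive root
    because \<open>t < s\<close>.\<close>
  have "1 - k\<^sup>2 = ((s + t)\<^sup>2 - 4 * (s * t)) / (s + t)\<^sup>2"
    using pos unfolding k_eq st power_divide d by (simp add: diff_divide_distrib)
  also have "(s + t)\<^sup>2 - 4 * (s * t) = (s - t)\<^sup>2"
    by (simp add: power2_eq_square algebra_simps)
  finally have "1 - k\<^sup>2 = ((s - t) / (s + t))\<^sup>2"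
    by (simp add: power_divide)
  then have k': "sqrt (1 - k\<^sup>2) = (s - t) / (s + t)"
    using pos less by simp
  define W where "W = (\<lambda>\<omega>. (B \<omega> * (Y3 \<omega> + Y3' \<omega>) + (1 - B \<omega>) * (Y2 \<omega> + Y2' \<omega> + 1),
      B \<omega> * (Y3 \<omega> - Y3' \<omega>) + (1 - B \<omega>) * (Y2 \<omega> - Y2' \<omega>)))"
  define f where "f = (\<lambda>(m, n). a * of_int m + b * of_int n :: real)"
  have [measurable]: "Y3 \<in> measurable N (count_space UNIV)" "Y3' \<in> measurable N (count_space UNIV)"
    "Y2 \<in> measurable N (count_space UNIV)" "Y2' \<in> measurable N (count_space UNIV)"
    "B \<in> measurable N (count_space UNIV)" "X \<in> measurable M (count_space UNIV)"
    "X' \<in> measurable M (count_space UNIV)"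
    using Y3 Y3' Y2 Y2' B X X'
    by (simp_all add: theta3_distributed_def theta2_distributed_def bernoulli_distributed_def)
  have WN: "W \<in> measurable N (count_space UNIV)"
    unfolding W_def by measurable
  have XM: "(\<lambda>\<omega>. (X \<omega>, X' \<omega>)) \<in> measurable M (count_space UNIV)"
    by measurable
  have "measure M {\<omega> \<in> space M. (X \<omega>, X' \<omega>) = (m, n)} = measure N {\<omega> \<in> space N. W \<omega> = (m, n)}" for m n
    unfolding prob_space.indep_var_prob_two[OF M indep_X] W_def
      discrete_gauss_mixture_point_probabilities[OF c_pos N Y3 Y3' Y2 Y2' q_eq p_eq p2 B indep_Y]
    using X X' by (simp add: theta3_distributed_def q_eq mult.commute)
  then have "distr M (count_space UNIV) (\<lambda>\<omega>. (X \<omega>, X' \<omega>)) = distr N (count_space UNIV) W"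
    by (intro distr_eq_if_point_probabilities_eq M N XM WN) (simp only: split_paired_all)
  then have "distr (distr M (count_space UNIV) (\<lambda>\<omega>. (X \<omega>, X' \<omega>))) borel f =
      distr (distr N (count_space UNIV) W) borel f"
    by simp
  then have "distr M borel (f \<circ> (\<lambda>\<omega>. (X \<omega>, X' \<omega>))) = distr N borel (f \<circ> W)"
    using WN XM by (simp add: distr_distr)
  \<comment> \<open>Linearity of \<open>f\<close> carries the coefficients \<open>B\<close> and
    \<open>1 - B\<close> through at every sample point, whatever integer \<open>B\<close> takes
    there.\<close>
  moreover have "f \<circ> W = (\<lambda>\<omega>. of_int (B \<omega>) * Z3 \<omega> + (1 - of_int (B \<omega>)) * Z2 \<omega>)"
    by (simp add: fun_eq_iff f_def W_def Z3_eq Z2_eq algebra_simps)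
  moreover have "f \<circ> (\<lambda>\<omega>. (X \<omega>, X' \<omega>)) = (\<lambda>\<omega>. a * of_int (X \<omega>) + b * of_int (X' \<omega>))"
    by (simp add: fun_eq_iff f_def)
  ultimately have "distr M borel (\<lambda>\<omega>. a * of_int (X \<omega>) + b * of_int (X' \<omega>)) =
      distr N borel (\<lambda>\<omega>. of_int (B \<omega>) * Z3 \<omega> + (1 - of_int (B \<omega>)) * Z2 \<omega>)"
    by simp
  moreover have "exp (- 2 * pi * c) = q\<^sup>2"
    by (simp add: q_eq flip: exp_double)
  then have "p = (theta3 (exp (- 2 * pi * c)))\<^sup>2 / (theta3 (exp (- pi * c)))\<^sup>2"
    unfolding p_eq by (simp only: q_eq)
  moreover have "p = (1 + sqrt (1 - k\<^sup>2)) / 2" "1 - p = (1 - sqrt (1 - k\<^sup>2)) / 2"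
    unfolding k' one_p unfolding p using pos by (simp_all add: field_simps)
  moreover have "p = 1 / (1 + elliptic_modulus (q\<^sup>2))"
    "1 - p = elliptic_modulus (q\<^sup>2) / (1 + elliptic_modulus (q\<^sup>2))"
    unfolding modulus2 one_p unfolding p using pos by (simp_all add: field_simps)
  ultimately show ?thesis
    using p2 by (intro conjI)
qed

end
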